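(* Let $S=\mathbb{Q}[x_1,\ldots,x_n]$, and let the fans $P_1(\mathrm{A}_n)$, $P_2(\mathrm{A}_n)$ and the graded $S$-module $D(\mathrm{A}_n)$ of logarithmic vector fields on the reflection arrangement $\mathrm{A}_n$ be as defined in the context. Then, for both families of fans, $C^0(\Sigma)$ is isomorphic to the module of logarithmic vector fields on $\mathrm{A}_n$; that is, there are isomorphisms of graded $S$-modules $$C^0(P_1(\mathrm{A}_n))\simeq D(\mathrm{A}_n)\qquad\text{and}\qquad C^0(P_2(\mathrm{A}_n))\simeq D(\mathrm{A}_n).$$
   Context: For an $n$-dimensional polyhedral fan $\Sigma$ in $\mathbb{Q}^n$, $C^0(\Sigma)$ (rational coefficients) is the graded $S$-module of piecewise polynomial functions on $\Sigma$: tuples $(f_\sigma)$ of polynomials $f_\sigma\in S$, indexed by the $n$-dimensional cones $\sigma$ of $\Sigma$, such that $f_\sigma|_\tau=f_{\sigma'}|_\tau$ whenever $\sigma,\sigma'$ share the $(n-1)$-dimensional face $\tau$. It is graded by polynomial degree. Fans. Let $\mathbf{e}_1,\ldots,\mathbf{e}_n$ be the standard basis of $\mathbb{Q}^n$. (1) $P_1(\mathrm{A}_n)$ is the fan whose toric variety is projective space $\mathbb{P}^n$: its maximal cones are generated by the $n$-element subsets of $\{\mathbf{e}_1,\ldots,\mathbf{e}_n,-\sum_j\mathbf{e}_j\}$. (2) Let $v_i=(n+1)\mathbf{e}_i-\sum_{j=1}^n\mathbf{e}_j$ for $1\le i\le n$. $P_2(\mathrm{A}_n)$ is the fan whose maximal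 cones are $a_0=\mathrm{cone}\{\mathbf{e}_1,\ldots,\mathbf{e}_n\}$ and, for $1\le i\le n$, $a_i=\mathrm{cone}\{v_j,\mathbf{e}_j : 1\le j\le n,\ j\ne i\}$. It is a subdivision of $\mathrm{cone}\{v_1,\ldots,v_n\}$. Module of logarithmic vector fields. Let $R=\mathbb{Q}[x_1,\ldots,x_{n+1}]$, and let $\mathrm{A}_n$ be the reflection (braid) arrangement of hyperplanes $V(x_j-x_i)$, $1\le i<j\le n+1$, in $(n+1)$-dimensional space. Let $$D_R(\mathrm{A}_n)=\{\theta\in \mathrm{Der}_{\mathbb{Q}}(R)\mid \theta(x_j-x_i)\in\langle x_j-x_i\rangle\text{ for all }1\le i<j\le n+1\},$$ graded by the polynomial degree of the coefficients of $\theta$ with respect to the basis $\partial/\partial x_1,\ldots,\partial/\partial x_{n+1}$. It is regarded as a module over $S\cong R/(x_{n+1})$ by specializing $x_{n+1}=0$: $D(\mathrm{A}_n):=D_R(\mathrm{A}_n)\otimes_R R/(x_{n+1})$.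
   Formalization: The isomorphism for P_2(A_n) is stated only for n ≥ 3: it fails for n = 1 (C^0 has rank 1, D(A_1) rank 2) and n = 2 (C^0 has generators in degrees 0,1,1, D(A_2) in degrees 0,1,2). The claim for P_1(A_n) covers all n ≥ 1. *)

theory Defs
  imports
    "HOL-Analysis.Analysis"
    "HOL-Library.Poly_Mapping"
    "HOL-Algebra.Free_Abelian_Groups"
    "HOL-Algebra.Module"
begin

text \<open>The polynomial ring with rational coefficients and variables indexed by the type \<open>'v\<close>,
  as the monoid algebra of the exponent vectors. For finite \<open>'n\<close> with \<open>n = CARD('n)\<close>,
  \<open>'n mpoly\<close> is the ring \<open>S\<close> in the variables \<open>x_1, ..., x_n\<close>, and \<open>'n option mpoly\<close> is the
  ring \<open>R\<close>, where \<open>None\<close> is the index of the extra variable \<open>x_(n+1)\<close>.\<close>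

type_synonym 'v mpoly = "('v \<Rightarrow>\<^sub>0 nat) \<Rightarrow>\<^sub>0 rat"

definition Var :: "'v \<Rightarrow> 'v mpoly" where
  "Var i = Poly_Mapping.single (Poly_Mapping.single i 1) 1"

definition Const :: "rat \<Rightarrow> 'v mpoly" where
  "Const c = Poly_Mapping.single 0 c"

definition homogeneous :: "nat \<Rightarrow> 'v::finite mpoly \<Rightarrow> bool" where
  "homogeneous d p \<longleftrightarrow>
     (\<forall>m \<in> Poly_Mapping.keys p. (\<Sum>i\<in>UNIV. Poly_Mapping.lookup m i) = d)"

definition substitute ::
    "(rat \<Rightarrow> 'a) \<Rightarrow> ('v::finite \<Rightarrow> 'a) \<Rightarrow> 'v mpoly \<Rightarrow> 'a::comm_semiring_1" where
  "substitute h x p =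
     (\<Sum>m \<in> Poly_Mapping.keys p.
        h (Poly_Mapping.lookup p m) * (\<Prod>i\<in>UNIV. x i ^ Poly_Mapping.lookup m i))"

definition eval_at :: "'n::finite mpoly \<Rightarrow> rat ^ 'n \<Rightarrow> rat" where
  "eval_at p x = substitute (\<lambda>c. c) (\<lambda>i. x $ i) p"

text \<open>The surjection from \<open>R\<close> to \<open>S\<close> that sets the extra variable to \<open>0\<close>. Its kernel is the
  ideal of the extra variable, so it is the projection of \<open>R\<close> onto \<open>R / (x_(n+1))\<close> under the
  identification of that quotient with \<open>S\<close>.\<close>

definition specialize :: "'n::finite option mpoly \<Rightarrow> 'n mpoly" where
  "specialize p = substitute Const (case_option 0 Var) p"

text \<open>The scalars are always all elements of the type \<open>'a\<close>. The ring fields \<open>mult\<close> and \<open>one\<close> inherited from the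
  ring record play no role for a module and are left undefined below.\<close>

record ('a, 'b) graded_module = "('a, 'b) module" +
  component :: "nat \<Rightarrow> 'b set"

definition graded_isomorphic ::
    "('a, 'b) graded_module \<Rightarrow> ('a, 'c) graded_module \<Rightarrow> bool" where
  "graded_isomorphic M N \<longleftrightarrow>
     (\<exists>\<phi>. bij_betw \<phi> (carrier M) (carrier N) \<and>
       (\<forall>x \<in> carrier M. \<forall>y \<in> carrier M. \<phi> (x \<oplus>\<^bsub>M\<^esub> y) = \<phi> x \<oplus>\<^bsub>N\<^esub> \<phi> y) \<and>
       (\<forall>a. \<forall>x \<in> carrier M. \<phi> (a \<odot>\<^bsub>M\<^esub> x) = a \<odot>\<^bsub>N\<^esub> \<phi> x) \<and>
       (\<forall>d. \<phi> ` component M d = component N d))"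

text \<open>For a ring homomorphism \<open>h\<close> from \<open>'r\<close> to a polynomial ring \<open>S\<close> and an \<open>'r\<close>-module \<open>M\<close>, the
  tensor product of \<open>M\<close> and \<open>S\<close> over \<open>'r\<close>: the free abelian group on the pairs \<open>(x, s)\<close> modulo the
  subgroup generated by the bilinearity relations. \<open>S\<close> acts on the second factor.\<close>

definition tensor_free ::
    "('r, 'm) graded_module \<Rightarrow> (('m \<times> 's mpoly) \<Rightarrow>\<^sub>0 int) monoid" where
  "tensor_free M = free_Abelian_group (carrier M \<times> UNIV)"

definition tensor_relations ::
    "('r \<Rightarrow> 's mpoly) \<Rightarrow> ('r, 'm) graded_module \<Rightarrow> (('m \<times> 's mpoly) \<Rightarrow>\<^sub>0 int) set" where
  "tensor_relations h M =
     {frag_of (x \<oplus>\<^bsub>M\<^esub> y, s) - frag_of (x, s) - frag_of (y, s) | x y s.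
        x \<in> carrier M \<and> y \<in> carrier M} \<union>
     {frag_of (x, s + t) - frag_of (x, s) - frag_of (x, t) | x s t. x \<in> carrier M} \<union>
     {frag_of (r \<odot>\<^bsub>M\<^esub> x, s) - frag_of (x, h r * s) | r x s. x \<in> carrier M}"

definition tensor_subgroup ::
    "('r \<Rightarrow> 's mpoly) \<Rightarrow> ('r, 'm) graded_module \<Rightarrow> (('m \<times> 's mpoly) \<Rightarrow>\<^sub>0 int) set" where
  "tensor_subgroup h M = generate (tensor_free M) (tensor_relations h M)"

definition tensor_group ::
    "('r \<Rightarrow> 's mpoly) \<Rightarrow> ('r, 'm) graded_module \<Rightarrow> (('m \<times> 's mpoly) \<Rightarrow>\<^sub>0 int) set monoid" where
  "tensor_group h M = tensor_free M Mod tensor_subgroup h M"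

definition pure_tensor ::
    "('r \<Rightarrow> 's mpoly) \<Rightarrow> ('r, 'm) graded_module \<Rightarrow> 'm \<Rightarrow> 's mpoly \<Rightarrow>
     (('m \<times> 's mpoly) \<Rightarrow>\<^sub>0 int) set" where
  "pure_tensor h M x s = tensor_subgroup h M #>\<^bsub>tensor_free M\<^esub> frag_of (x, s)"

text \<open>Multiplication by \<open>a\<close> sends the class of \<open>(x, s)\<close> to the class of \<open>(x, a * s)\<close>: a coset \<open>C\<close> is
  mapped elementwise, and adding the subgroup turns the image into a full coset again.\<close>

definition extend_scalars ::
    "('r \<Rightarrow> 's::finite mpoly) \<Rightarrow> ('r, 'm) graded_module \<Rightarrow>
     ('s mpoly, (('m \<times> 's mpoly) \<Rightarrow>\<^sub>0 int) set) graded_module" where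
  "extend_scalars h M =
     \<lparr>carrier = carrier (tensor_group h M),
      monoid.mult = undefined,
      one = undefined,
      zero = \<one>\<^bsub>tensor_group h M\<^esub>,
      add = (\<lambda>C D. C \<otimes>\<^bsub>tensor_group h M\<^esub> D),
      smult = (\<lambda>a C. tensor_subgroup h M
                 <#>\<^bsub>tensor_free M\<^esub> frag_extend (\<lambda>(x, s). frag_of (x, a * s)) ` C),
      component = (\<lambda>d. generate (tensor_group h M)
                 {pure_tensor h M x s | i j x s.
                    i + j = d \<and> x \<in> component M i \<and> homogeneous j s})\<rparr>"

definition is_derivation :: "('v mpoly \<Rightarrow> 'v mpoly) \<Rightarrow> bool" where
  "is_derivation \<theta> \<longleftrightarrow>
     (\<forall>p q. \<theta> (p + q) = \<theta> p + \<theta> q) \<and>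
     (\<forall>c p. \<theta> (Const c * p) = Const c * \<theta> p) \<and>
     (\<forall>p q. \<theta> (p * q) = \<theta> p * q + p * \<theta> q)"

definition log_derivations :: "('v mpoly \<Rightarrow> 'v mpoly) set" where
  "log_derivations =
     {\<theta>. is_derivation \<theta> \<and> (\<forall>i j. i \<noteq> j \<longrightarrow> (Var j - Var i) dvd \<theta> (Var j - Var i))}"

text \<open>The module of logarithmic derivations for the hyperplanes \<open>x_i = x_j\<close>, over the polynomial ring
  in all variables of type \<open>'v\<close>. The coefficient of \<open>\<theta>\<close> at the \<open>i\<close>-th partial derivative is
  \<open>\<theta> (Var i)\<close>.\<close>

definition log_module :: "('v::finite mpoly, 'v mpoly \<Rightarrow> 'v mpoly) graded_module" where
  "log_module =
     \<lparr>carrier = log_derivations,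
      monoid.mult = undefined,
      one = undefined,
      zero = (\<lambda>p. 0),
      add = (\<lambda>\<theta> \<eta> p. \<theta> p + \<eta> p),
      smult = (\<lambda>a \<theta> p. a * \<theta> p),
      component = (\<lambda>d. {\<theta> \<in> log_derivations. \<forall>i. homogeneous d (\<theta> (Var i))})\<rparr>"

definition D_braid ::
    "('n::finite mpoly,
      ((('n option mpoly \<Rightarrow> 'n option mpoly) \<times> 'n mpoly) \<Rightarrow>\<^sub>0 int) set) graded_module" where
  "D_braid = extend_scalars specialize log_module"

definition cone_gen :: "(rat ^ 'n) set \<Rightarrow> (rat ^ 'n) set" where
  "cone_gen V = {\<Sum>v\<in>V. c v *s v | c. \<forall>v\<in>V. 0 \<le> c v}"

definition cone_face :: "(rat ^ 'n::finite) set \<Rightarrow> (rat ^ 'n) set \<Rightarrow> bool" where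
  "cone_face \<tau> \<sigma> \<longleftrightarrow>
     (\<exists>u :: rat ^ 'n. (\<forall>x\<in>\<sigma>. 0 \<le> (\<Sum>i\<in>UNIV. u $ i * x $ i)) \<and>
        \<tau> = {x \<in> \<sigma>. (\<Sum>i\<in>UNIV. u $ i * x $ i) = 0})"

definition fan_of :: "(rat ^ 'n::finite) set set \<Rightarrow> (rat ^ 'n) set set" where
  "fan_of \<M> = {\<tau>. \<exists>\<sigma>\<in>\<M>. cone_face \<tau> \<sigma>}"

definition top_cones :: "(rat ^ 'n::finite) set set \<Rightarrow> (rat ^ 'n) set set" where
  "top_cones \<Sigma> = {\<sigma> \<in> \<Sigma>. vec.dim \<sigma> = CARD('n)}"

text \<open>A tuple indexed by the top-dimensional cones is a function on all subsets of the space that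
  vanishes outside the index set.\<close>

definition piecewise_polynomials ::
    "(rat ^ 'n::finite) set set \<Rightarrow> ((rat ^ 'n) set \<Rightarrow> 'n mpoly) set" where
  "piecewise_polynomials \<Sigma> =
     {f. (\<forall>\<sigma>. \<sigma> \<notin> top_cones \<Sigma> \<longrightarrow> f \<sigma> = 0) \<and>
         (\<forall>\<sigma> \<in> top_cones \<Sigma>. \<forall>\<sigma>' \<in> top_cones \<Sigma>. \<forall>\<tau>.
            cone_face \<tau> \<sigma> \<and> cone_face \<tau> \<sigma>' \<and> vec.dim \<tau> = CARD('n) - 1 \<longrightarrow>
            (\<forall>x\<in>\<tau>. eval_at (f \<sigma>) x = eval_at (f \<sigma>') x))}"

definition C0 ::
    "(rat ^ 'n::finite) set set \<Rightarrow> ('n mpoly, (rat ^ 'n) set \<Rightarrow> 'n mpoly) graded_module" where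
  "C0 \<Sigma> =
     \<lparr>carrier = piecewise_polynomials \<Sigma>,
      monoid.mult = undefined,
      one = undefined,
      zero = (\<lambda>\<sigma>. 0),
      add = (\<lambda>f g \<sigma>. f \<sigma> + g \<sigma>),
      smult = (\<lambda>a f \<sigma>. a * f \<sigma>),
      component = (\<lambda>d. {f \<in> piecewise_polynomials \<Sigma>. \<forall>\<sigma> \<in> top_cones \<Sigma>. homogeneous d (f \<sigma>)})\<rparr>"

definition P1_fan :: "(rat ^ 'n::finite) set set" where
  "P1_fan = fan_of
     {cone_gen V | V.
        V \<subseteq> insert (- (\<Sum>j\<in>UNIV. axis j 1)) (range (\<lambda>i. axis i 1)) \<and> card V = CARD('n)}"

definition P2_vertex :: "'n::finite \<Rightarrow> rat ^ 'n" where
  "P2_vertex i = (of_nat CARD('n) + 1) *s axis i 1 - (\<Sum>j\<in>UNIV. axis j 1)"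

text \<open>For \<open>CARD('n) = 1\<close> the cone of the second kind is \<open>{0}\<close>, and for \<open>CARD('n) = 2\<close> the two
  cones of the second kind meet only in \<open>0\<close>, so that the fan imposes fewer conditions than the braid
  arrangement does. From \<open>CARD('n) = 3\<close> on, any two of the cones share a facet.\<close>

definition P2_fan :: "(rat ^ 'n::finite) set set" where
  "P2_fan = fan_of
     (insert (cone_gen (range (\<lambda>i. axis i 1)))
        {cone_gen (P2_vertex ` {j. j \<noteq> i} \<union> (\<lambda>j. axis j 1) ` {j. j \<noteq> i}) | i. True})"

end

theory Submission
  imports Defs
begin

text \<open>
  Write \<open>y\<^sub>1, ..., y\<^sub>n\<close> for the coordinate forms \<open>x\<^sub>1, ..., x\<^sub>n\<close> on \<open>\<rat>\<^sup>n\<close> and \<open>y\<^bsub>n+1\<^esub>\<close> for the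
  zero form. These are the images of the variables of \<open>R\<close> under the specialization; the index \<open>n + 1\<close>
  is represented by \<open>None\<close>. All modules of the theorem are isomorphic to the module \<open>braid_splines\<close>
  of splines on the complete graph: the tuples \<open>(F\<^sub>1, ..., F\<^bsub>n+1\<^esub>)\<close> of polynomials in \<open>S\<close> for which
  \<open>y\<^sub>a - y\<^sub>b\<close> divides \<open>F\<^sub>a - F\<^sub>b\<close> for all \<open>a\<close> and \<open>b\<close>.

  A derivation of \<open>R\<close> is determined by its coefficients, which are arbitrary, and it is logarithmic
  exactly if \<open>x\<^sub>a - x\<^sub>b\<close> divides the difference of the coefficients with indices \<open>a\<close> and \<open>b\<close>. So
  logarithmic derivations are splines over \<open>R\<close>, and specializing the coefficients gives splines over
  \<open>S\<close>. That this becomes an isomorphism after extension of scalars is due to the homomorphism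
  \<open>translate\<close> from \<open>S\<close> to \<open>R\<close> with \<open>x\<^sub>i \<mapsto> x\<^sub>i - x\<^bsub>n+1\<^esub>\<close>, a section of the specialization that
  maps \<open>y\<^sub>a - y\<^sub>b\<close> to \<open>x\<^sub>a - x\<^sub>b\<close>. It lifts splines over \<open>S\<close> to logarithmic derivations, with degrees
  preserved. If all specialized coefficients of a logarithmic derivation vanish, then it is \<open>x\<^bsub>n+1\<^esub>\<close>
  times a logarithmic derivation (\<open>Var_diff_dvd_cancel_Var\<close>), and so it becomes \<open>0\<close> in the tensor
  product. This shows that every pure tensor comes from a spline (\<open>pure_tensor_eq_spline_tensor\<close>).
  Conversely, the specialized coefficients of a tensor are well defined and recover the spline
  (\<open>spline_tensor_inj\<close>).

  The maximal cones of both fans have a uniform description (\<open>P1_cone\<close>, \<open>P2_cone_None\<close>,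
  \<open>P2_cone_Some\<close>). The cone with index \<open>a\<close> of the first fan is the region where \<open>y\<^sub>a\<close> is the smallest
  of the forms \<open>y\<^sub>1, ..., y\<^bsub>n+1\<^esub>\<close>, and in the second fan the inequality
  \<open>x\<^sub>1 + ... + x\<^sub>n + y\<^sub>a \<ge> 0\<close> is added. This makes it evident that any two cones are separated by the
  hyperplane \<open>y\<^sub>a = y\<^sub>b\<close> and that they have the same intersection with it, which is a common face.
  The face is Zariski dense in the hyperplane, for the second fan because of \<open>n \<ge> 3\<close>. So two
  polynomials agree on it exactly if \<open>y\<^sub>a - y\<^sub>b\<close> divides their difference
  (\<open>dvd_if_zero_on_deep_wall\<close>, \<open>piecewise_polynomials_chambers\<close>), and piecewise polynomials are
  splines on the complete graph.
\<close>

section \<open>Substitution homomorphisms\<close>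

definition ring_morphism :: "('a::comm_semiring_1 \<Rightarrow> 'b::comm_semiring_1) \<Rightarrow> bool" where
  "ring_morphism \<phi> \<longleftrightarrow> \<phi> 1 = 1 \<and> (\<forall>p q. \<phi> (p + q) = \<phi> p + \<phi> q) \<and> (\<forall>p q. \<phi> (p * q) = \<phi> p * \<phi> q)"

lemma ring_morphism_simps:
  assumes "ring_morphism \<phi>"
  shows "\<phi> 1 = 1" "\<phi> (p + q) = \<phi> p + \<phi> q" "\<phi> (p * q) = \<phi> p * \<phi> q"
  using assms by (auto simp: ring_morphism_def)

lemma ring_morphism_0:
  fixes \<phi> :: "'a::comm_ring_1 \<Rightarrow> 'b::comm_ring_1"
  assumes "ring_morphism \<phi>"
  shows "\<phi> 0 = 0"
  using ring_morphism_simps(2)[OF assms, of 0 0] by simp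

lemma ring_morphism_diff:
  fixes \<phi> :: "'a::comm_ring_1 \<Rightarrow> 'b::comm_ring_1"
  assumes "ring_morphism \<phi>"
  shows "\<phi> (p - q) = \<phi> p - \<phi> q"
  using ring_morphism_simps(2)[OF assms, of "p - q" q] by simp

lemma ring_morphism_dvd:
  assumes "ring_morphism \<phi>" "p dvd q"
  shows "\<phi> p dvd \<phi> q"
  using assms(2) by (auto simp: dvd_def ring_morphism_simps[OF assms(1)])

lemma ring_morphism_comp:
  assumes "ring_morphism \<phi>" "ring_morphism \<psi>"
  shows "ring_morphism (\<lambda>p. \<psi> (\<phi> p))"
  using assms by (simp add: ring_morphism_def)

lemma ring_morphism_id: "ring_morphism (\<lambda>p. p)"
  by (simp add: ring_morphism_def)

lemma ring_morphism_sum: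
  fixes \<phi> :: "'a::comm_ring_1 \<Rightarrow> 'b::comm_ring_1"
  assumes "ring_morphism \<phi>"
  shows "\<phi> (\<Sum>i\<in>I. f i) = (\<Sum>i\<in>I. \<phi> (f i))"
  by (induction I rule: infinite_finite_induct)
    (simp_all add: ring_morphism_0[OF assms] ring_morphism_simps[OF assms])

lemma ring_morphism_prod:
  assumes "ring_morphism \<phi>"
  shows "\<phi> (\<Prod>i\<in>I. f i) = (\<Prod>i\<in>I. \<phi> (f i))"
  by (induction I rule: infinite_finite_induct) (simp_all add: ring_morphism_simps[OF assms])

lemma ring_morphism_power:
  assumes "ring_morphism \<phi>"
  shows "\<phi> (p ^ k) = \<phi> p ^ k"
  by (induction k) (simp_all add: ring_morphism_simps[OF assms])

lemma Const_ring_morphism: "ring_morphism Const"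
  by (simp add: ring_morphism_def Const_def single_add mult_single)

lemma Const_simps [simp]: "Const 0 = 0" "Const 1 = 1"
  by (simp_all add: Const_def)

lemma sum_of_monomials:
  fixes p :: "'k \<Rightarrow>\<^sub>0 'c::comm_monoid_add"
  shows "p = (\<Sum>m\<in>Poly_Mapping.keys p. Poly_Mapping.single m (Poly_Mapping.lookup p m))"
proof (rule poly_mapping_eqI)
  fix k
  show "Poly_Mapping.lookup p k =
    Poly_Mapping.lookup (\<Sum>m\<in>Poly_Mapping.keys p. Poly_Mapping.single m (Poly_Mapping.lookup p m)) k"
    by (auto simp: lookup_sum lookup_single when_def in_keys_iff)
qed

lemma mpoly_induct [case_names monomial add]:
  fixes p :: "'v mpoly"
  assumes "\<And>m c. P (Poly_Mapping.single m c)" and "\<And>p q. P p \<Longrightarrow> P q \<Longrightarrow> P (p + q)"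
  shows "P p"
proof -
  have "P (\<Sum>m\<in>M. Poly_Mapping.single m (c m))" if "finite M" for M :: "('v \<Rightarrow>\<^sub>0 nat) set" and c
    using that
  proof (induction M)
    case empty
    have "P (Poly_Mapping.single 0 0)" by (rule assms(1))
    then show ?case by simp
  qed (simp add: assms)
  then show ?thesis
    by (subst sum_of_monomials) simp
qed

lemma monomial_eq_prod:
  "Poly_Mapping.single m c = Const c * (\<Prod>i\<in>UNIV. Var i ^ Poly_Mapping.lookup m (i :: 'v::finite))"
proof -
  have pow: "Var i ^ k = Poly_Mapping.single (Poly_Mapping.single i k) 1" for i :: 'v and k
    by (induction k) (simp_all add: Var_def mult_single flip: single_add)
  have prod: "(\<Prod>i\<in>I. Poly_Mapping.single (f i) (1::rat)) = Poly_Mapping.single (\<Sum>i\<in>I. f i) 1"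
    if "finite I" for I :: "'v set" and f :: "'v \<Rightarrow> 'v \<Rightarrow>\<^sub>0 nat"
    using that by (induction I) (simp_all add: mult_single)
  have "(\<Sum>i\<in>UNIV. Poly_Mapping.single i (Poly_Mapping.lookup m i)) = m"
    by (rule poly_mapping_eqI) (simp add: lookup_sum lookup_single when_def)
  then show ?thesis
    by (simp add: pow prod Const_def mult_single)
qed

lemma substitute_monomial:
  assumes "h 0 = 0"
  shows "substitute h x (Poly_Mapping.single m c) = h c * (\<Prod>i\<in>UNIV. x i ^ Poly_Mapping.lookup m i)"
  using assms by (cases "c = 0") (simp_all add: substitute_def)

lemma substitute_ring_morphism:
  fixes x :: "'v::finite \<Rightarrow> 'a::comm_ring_1"
  assumes h: "ring_morphism h"
  shows "ring_morphism (substitute h x)"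
proof -
  note h0 = ring_morphism_0[OF h] and hs = ring_morphism_simps[OF h]
  have add: "substitute h x (p + q) = substitute h x p + substitute h x q" for p q
    unfolding substitute_def
    by (rule setsum_keys_plus_distrib) (simp_all add: h0 hs distrib_right)
  have mult: "substitute h x (p * q) = substitute h x p * substitute h x q" for p q
  proof (induction p rule: mpoly_induct)
    case (monomial m a)
    show ?case
    proof (induction q rule: mpoly_induct)
      case (monomial k b)
      show ?case
        by (simp add: mult_single substitute_monomial h0 hs lookup_add power_add prod.distrib
            mult_ac)
    qed (simp add: distrib_left add)
  qed (simp add: distrib_right add)
  have "substitute h x 1 = 1"
    using substitute_monomial[of h x 0 1] by (simp add: h0 hs)
  with add mult show ?thesis
    by (simp add: ring_morphism_def)
qed

lemma substitute_Const [simp]: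
  assumes "ring_morphism (h :: rat \<Rightarrow> 'a::comm_ring_1)"
  shows "substitute h x (Const c) = h c"
  using ring_morphism_0[OF assms] by (simp add: Const_def substitute_monomial)

lemma substitute_Var [simp]:
  assumes "ring_morphism (h :: rat \<Rightarrow> 'a::comm_ring_1)"
  shows "substitute h x (Var i) = x i"
proof -
  have "(\<Prod>j\<in>UNIV. x j ^ Poly_Mapping.lookup (Poly_Mapping.single i 1) j) = (\<Prod>j\<in>UNIV. if j = i then x j else 1)"
    by (rule prod.cong) (auto simp: lookup_single)
  then show ?thesis
    using ring_morphism_0[OF assms] ring_morphism_simps[OF assms]
    by (simp add: Var_def substitute_monomial)
qed

lemma ring_morphism_eq_substitute:
  fixes \<phi> :: "'v::finite mpoly \<Rightarrow> 'a::comm_ring_1"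
  assumes "ring_morphism \<phi>"
  shows "\<phi> p = substitute (\<lambda>c. \<phi> (Const c)) (\<lambda>i. \<phi> (Var i)) p"
proof -
  have "\<phi> p = \<phi> (\<Sum>m\<in>Poly_Mapping.keys p. Poly_Mapping.single m (Poly_Mapping.lookup p m))"
    by (simp flip: sum_of_monomials)
  then show ?thesis
    by (simp add: substitute_def monomial_eq_prod ring_morphism_sum[OF assms]
        ring_morphism_simps[OF assms] ring_morphism_prod[OF assms] ring_morphism_power[OF assms])
qed

lemma ring_morphism_unique:
  fixes \<phi> \<psi> :: "'v::finite mpoly \<Rightarrow> 'a::comm_ring_1"
  assumes "ring_morphism \<phi>" "ring_morphism \<psi>"
    and "\<And>c. \<phi> (Const c) = \<psi> (Const c)" "\<And>i. \<phi> (Var i) = \<psi> (Var i)"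
  shows "\<phi> p = \<psi> p"
  using ring_morphism_eq_substitute[OF assms(1), of p] ring_morphism_eq_substitute[OF assms(2), of p]
    assms(3,4) by simp

text \<open>Modulo \<open>d\<close> the substitution fixes every variable, hence every polynomial.\<close>

lemma dvd_diff_substitute:
  fixes g :: "'v::finite \<Rightarrow> 'v mpoly"
  assumes "\<And>i. d dvd Var i - g i"
  shows "d dvd p - substitute Const g p"
proof -
  have cong: "d dvd s * t - s' * t'" if "d dvd s - s'" "d dvd t - t'" for s t s' t' :: "'v mpoly"
  proof -
    have "s * t - s' * t' = (s - s') * t + s' * (t - t')"
      by (simp add: algebra_simps)
    then show ?thesis using that by simp
  qed
  have pow: "d dvd Var i ^ k - g i ^ k" for i k
    by (induction k) (auto intro: cong assms)
  have prod: "d dvd (\<Prod>i\<in>I. Var i ^ k i) - (\<Prod>i\<in>I. g i ^ k i)" if "finite I" for I k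
    using that by (induction I) (auto intro: cong pow)
  show ?thesis
  proof (induction p rule: mpoly_induct)
    case (monomial m c)
    have "d dvd Const c * (\<Prod>i\<in>UNIV. Var i ^ Poly_Mapping.lookup m i) -
        Const c * (\<Prod>i\<in>UNIV. g i ^ Poly_Mapping.lookup m i)"
      by (rule cong) (simp_all add: prod)
    then show ?case
      by (simp only: substitute_monomial[of Const, OF Const_simps(1)] monomial_eq_prod[symmetric])
  next
    case (add p q)
    then have "d dvd (p - substitute Const g p) + (q - substitute Const g q)"
      by (rule dvd_add)
    then show ?case
      by (simp add: ring_morphism_simps[OF substitute_ring_morphism[OF Const_ring_morphism]] algebra_simps)
  qed
qed

section \<open>Homogeneous polynomials\<close>

lemma homogeneous_0 [simp]: "homogeneous d 0"
  by (simp add: homogeneous_def)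

lemma homogeneous_add:
  assumes "homogeneous d p" "homogeneous d q" shows "homogeneous d (p + q)"
  using assms keys_add[of p q] unfolding homogeneous_def by blast

lemma homogeneous_uminus: "homogeneous d p \<Longrightarrow> homogeneous d (- p)"
  by (simp add: homogeneous_def)

lemma homogeneous_sum:
  assumes "\<And>i. i \<in> I \<Longrightarrow> homogeneous d (f i)" shows "homogeneous d (\<Sum>i\<in>I. f i)"
  using assms by (induction I rule: infinite_finite_induct) (auto intro: homogeneous_add)

lemma homogeneous_mult:
  assumes "homogeneous d p" "homogeneous e q" shows "homogeneous (d + e) (p * q)"
  unfolding homogeneous_def
proof
  fix m assume "m \<in> Poly_Mapping.keys (p * q)"
  then obtain k l where "m = k + l" "k \<in> Poly_Mapping.keys p" "l \<in> Poly_Mapping.keys q"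
    using keys_mult[of p q] by blast
  then show "(\<Sum>i\<in>UNIV. Poly_Mapping.lookup m i) = d + e"
    using assms by (simp add: homogeneous_def lookup_add sum.distrib)
qed

lemma homogeneous_Const: "homogeneous 0 (Const c)"
  by (simp add: homogeneous_def Const_def)

lemma homogeneous_Var: "homogeneous 1 (Var i)"
  by (simp add: homogeneous_def Var_def lookup_single when_def)

lemma homogeneous_power: "homogeneous 1 p \<Longrightarrow> homogeneous k (p ^ k)"
proof (induction k)
  case 0 show ?case using homogeneous_Const[of 1] by simp
next
  case (Suc k) then show ?case using homogeneous_mult[of 1 p k "p ^ k"] by simp
qed

lemma homogeneous_prod:
  assumes "finite I" "\<And>i. i \<in> I \<Longrightarrow> homogeneous (k i) (f i)"
  shows "homogeneous (\<Sum>i\<in>I. k i) (\<Prod>i\<in>I. f i)"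
  using assms
proof (induction I)
  case empty show ?case using homogeneous_Const[of 1] by simp
qed (simp add: homogeneous_mult)

lemma homogeneous_substitute:
  assumes "\<And>i. homogeneous 1 (g i)" "homogeneous d p"
  shows "homogeneous d (substitute Const g p)"
  unfolding substitute_def
proof (rule homogeneous_sum)
  fix m assume "m \<in> Poly_Mapping.keys p"
  then have "(\<Sum>i\<in>UNIV. Poly_Mapping.lookup m i) = d"
    using assms(2) by (simp add: homogeneous_def)
  moreover have "homogeneous (\<Sum>i\<in>UNIV. Poly_Mapping.lookup m i) (\<Prod>i\<in>UNIV. g i ^ Poly_Mapping.lookup m i)"
    by (rule homogeneous_prod) (simp_all add: homogeneous_power[OF assms(1)])
  ultimately show "homogeneous d (Const (Poly_Mapping.lookup p m) * (\<Prod>i\<in>UNIV. g i ^ Poly_Mapping.lookup m i))"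
    using homogeneous_mult[OF homogeneous_Const] by fastforce
qed

section \<open>Polynomials that vanish on a box\<close>

lemma eval_at_ring_morphism: "ring_morphism (\<lambda>p. eval_at p x)"
  unfolding eval_at_def by (rule substitute_ring_morphism[OF ring_morphism_id])

lemma eval_at_simps:
  "eval_at (Const c) x = c" "eval_at (Var i) x = x $ i"
  "eval_at 0 x = 0" "eval_at (p - q) x = eval_at p x - eval_at q x"
  "eval_at (p * q) x = eval_at p x * eval_at q x"
  using ring_morphism_0[OF eval_at_ring_morphism] ring_morphism_diff[OF eval_at_ring_morphism]
    ring_morphism_simps[OF eval_at_ring_morphism]
  by (auto simp: eval_at_def ring_morphism_id)

lemma eval_at_substitute:
  "eval_at (substitute Const g p) x = eval_at p (\<chi> i. eval_at (g i) x)"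
  by (rule ring_morphism_unique[of "\<lambda>p. eval_at (substitute Const g p) x"])
    (simp_all add: ring_morphism_comp[OF substitute_ring_morphism[OF Const_ring_morphism] eval_at_ring_morphism]
      eval_at_ring_morphism eval_at_simps Const_ring_morphism)

text \<open>The coefficient sums make an induction on the set \<open>I\<close> of variables possible in which the
  exponents at the variables outside \<open>I\<close> are forgotten: monomials that agree on \<open>I\<close> need not be
  equal, so only the sum of their coefficients can be recovered. The induction step groups the
  monomials by the exponent of one variable and uses that a univariate polynomial with infinitely
  many roots is zero.\<close>

lemma coefficient_sums_zero_if_zero_on_box:
  fixes A :: "'v \<Rightarrow> rat set" and c :: "('v \<Rightarrow>\<^sub>0 nat) \<Rightarrow> rat"
  assumes "finite I" and "\<And>i. infinite (A i)" and "finite M"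
    and "\<And>x. (\<forall>i. x i \<in> A i) \<Longrightarrow> (\<Sum>m\<in>M. c m * (\<Prod>i\<in>I. x i ^ Poly_Mapping.lookup m i)) = 0"
  shows "(\<Sum>m | m \<in> M \<and> (\<forall>i\<in>I. Poly_Mapping.lookup m i = e i). c m) = 0"
  using assms(1,3,4)
proof (induction I arbitrary: M)
  case empty
  have "\<forall>i. \<exists>t. t \<in> A i"
    using infinite_imp_nonempty[OF assms(2)] by blast
  then obtain x where "\<And>i. x i \<in> A i"
    by metis
  then show ?case using empty.prems(2)[of x] by simp
next
  case (insert v I)
  define M' where "M' k = {m \<in> M. Poly_Mapping.lookup m v = k}" for k
  \<comment> \<open>The zero is inserted because the maximum of the empty set is unspecified.\<close>
  define N where "N = Max (insert 0 ((\<lambda>m. Poly_Mapping.lookup m v) ` M))"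
  have N: "Poly_Mapping.lookup m v \<le> N" if "m \<in> M" for m
    unfolding N_def using that insert.prems(1) by (intro Max_ge) auto
  have "(\<Sum>m\<in>M' k. c m * (\<Prod>i\<in>I. x i ^ Poly_Mapping.lookup m i)) = 0" if x: "\<forall>i. x i \<in> A i" for x k
  proof -
    define b where "b k = (\<Sum>m\<in>M' k. c m * (\<Prod>i\<in>I. x i ^ Poly_Mapping.lookup m i))" for k
    have "(\<Sum>k\<le>N. b k * t ^ k) = 0" if t: "t \<in> A v" for t
    proof -
      \<comment> \<open>Setting the variable \<open>v\<close> to \<open>t\<close> makes the polynomial univariate, with coefficients \<open>b\<close>.\<close>
      have "(\<Sum>k\<le>N. b k * t ^ k) =
          (\<Sum>k\<le>N. \<Sum>m | m \<in> M \<and> Poly_Mapping.lookup m v = k.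
             c m * (t ^ Poly_Mapping.lookup m v * (\<Prod>i\<in>I. x i ^ Poly_Mapping.lookup m i)))"
        by (auto simp: b_def M'_def sum_distrib_right intro!: sum.cong)
      also have "\<dots> = (\<Sum>m\<in>M. c m * (t ^ Poly_Mapping.lookup m v * (\<Prod>i\<in>I. x i ^ Poly_Mapping.lookup m i)))"
        using N insert.prems(1) by (intro sum.group) auto
      also have "\<dots> = (\<Sum>m\<in>M. c m * (\<Prod>i\<in>insert v I. (x(v := t)) i ^ Poly_Mapping.lookup m i))"
      proof (intro sum.cong refl)
        fix m
        have "(\<Prod>i\<in>I. (x(v := t)) i ^ Poly_Mapping.lookup m i) = (\<Prod>i\<in>I. x i ^ Poly_Mapping.lookup m i)"
          using insert.hyps by (intro prod.cong) auto
        then show "c m * (t ^ Poly_Mapping.lookup m v * (\<Prod>i\<in>I. x i ^ Poly_Mapping.lookup m i)) =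
            c m * (\<Prod>i\<in>insert v I. (x(v := t)) i ^ Poly_Mapping.lookup m i)"
          using insert.hyps by simp
      qed
      also have "\<dots> = 0"
        using x t by (intro insert.prems(2)) auto
      finally show ?thesis .
    qed
    define P where "P = (\<Sum>k\<le>N. Polynomial.monom (b k) k)"
    have "A v \<subseteq> {t. poly P t = 0}"
      using \<open>\<And>t. t \<in> A v \<Longrightarrow> (\<Sum>k\<le>N. b k * t ^ k) = 0\<close> by (auto simp: P_def poly_sum poly_monom)
    then have "P = 0"
      using assms(2)[of v] poly_roots_finite[of P] finite_subset by blast
    moreover have "poly.coeff P k = (if k \<le> N then b k else 0)" for k
      by (simp add: P_def coeff_sum)
    ultimately have "b k = 0" if "k \<le> N" for k
      using that by (metis coeff_0)
    moreover have "b k = 0" if "\<not> k \<le> N"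
      using that N by (auto simp: b_def M'_def intro!: sum.neutral)
    ultimately show ?thesis
      unfolding b_def by blast
  qed
  then have "(\<Sum>m | m \<in> M' (e v) \<and> (\<forall>i\<in>I. Poly_Mapping.lookup m i = e i). c m) = 0"
    using insert.prems(1) by (intro insert.IH) (auto simp: M'_def)
  moreover have "{m. m \<in> M' (e v) \<and> (\<forall>i\<in>I. Poly_Mapping.lookup m i = e i)} =
      {m. m \<in> M \<and> (\<forall>i\<in>insert v I. Poly_Mapping.lookup m i = e i)}"
    by (auto simp: M'_def)
  ultimately show ?case by simp
qed

lemma zero_if_zero_on_box:
  fixes A :: "'n::finite \<Rightarrow> rat set" and p :: "'n mpoly"
  assumes "\<And>i. infinite (A i)" and zero: "\<And>x. (\<forall>i. x $ i \<in> A i) \<Longrightarrow> eval_at p x = 0"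
  shows "p = 0"
proof (rule poly_mapping_eqI)
  fix k
  have "(\<Sum>m | m \<in> Poly_Mapping.keys p \<and> (\<forall>i\<in>UNIV. Poly_Mapping.lookup m i = Poly_Mapping.lookup k i).
      Poly_Mapping.lookup p m) = 0"
  proof (rule coefficient_sums_zero_if_zero_on_box[where A = A])
    fix x :: "'n \<Rightarrow> rat" assume "\<forall>i. x i \<in> A i"
    then show "(\<Sum>m\<in>Poly_Mapping.keys p. Poly_Mapping.lookup p m * (\<Prod>i\<in>UNIV. x i ^ Poly_Mapping.lookup m i)) = 0"
      using zero[of "\<chi> i. x i"] by (simp add: eval_at_def substitute_def)
  qed (use assms in auto)
  moreover have "{m. m \<in> Poly_Mapping.keys p \<and> (\<forall>i\<in>UNIV. Poly_Mapping.lookup m i = Poly_Mapping.lookup k i)} =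
      (if k \<in> Poly_Mapping.keys p then {k} else {})"
    by (auto simp flip: poly_mapping_eq_iff fun_eq_iff)
  ultimately show "Poly_Mapping.lookup p k = Poly_Mapping.lookup 0 k"
    by (auto simp: in_keys_iff split: if_splits)
qed

text \<open>The polynomial \<open>p\<close> vanishes wherever the variable does not, in particular on the open positive
  orthant, which is a box.\<close>

lemma Var_mult_eq_0:
  fixes p :: "'v::finite mpoly"
  assumes "Var v * p = 0" shows "p = 0"
proof (rule zero_if_zero_on_box[where A = "\<lambda>_. {0<..}"])
  fix x :: "rat ^ 'v" assume "\<forall>i. x $ i \<in> {0<..}"
  moreover have "eval_at (Var v * p) x = 0"
    by (simp add: assms eval_at_simps)
  ultimately show "eval_at p x = 0"
    by (metis eval_at_simps(2,5) greaterThan_iff less_irrefl mult_eq_0_iff)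
qed (rule infinite_Ioi)

section \<open>Derivations of a polynomial ring\<close>

text \<open>The derivation \<open>\<Sum>\<^sub>i g\<^sub>i \<partial>/\<partial>x\<^sub>i\<close>. Subtraction of exponents truncates at \<open>0\<close>, but the monomials for
  which that happens get the coefficient \<open>0\<close>.\<close>

definition derivation_of :: "('v::finite \<Rightarrow> 'v mpoly) \<Rightarrow> 'v mpoly \<Rightarrow> 'v mpoly" where
  "derivation_of g p = (\<Sum>m\<in>Poly_Mapping.keys p. \<Sum>i\<in>UNIV.
     g i * Poly_Mapping.single (m - Poly_Mapping.single i 1)
       (Poly_Mapping.lookup p m * of_nat (Poly_Mapping.lookup m i)))"

lemma derivation_of_monomial:
  "derivation_of g (Poly_Mapping.single m c) =
     (\<Sum>i\<in>UNIV. g i * Poly_Mapping.single (m - Poly_Mapping.single i 1) (c * of_nat (Poly_Mapping.lookup m i)))"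
  by (cases "c = 0") (simp_all add: derivation_of_def)

lemma derivation_of_add: "derivation_of g (p + q) = derivation_of g p + derivation_of g q"
  unfolding derivation_of_def
  by (rule setsum_keys_plus_distrib) (simp_all add: distrib_right distrib_left single_add sum.distrib)

lemma derivation_of_mult: "derivation_of g (p * q) = derivation_of g p * q + p * derivation_of g q"
proof (induction p rule: mpoly_induct)
  case (monomial m a)
  show ?case
  proof (induction q rule: mpoly_induct)
    case (monomial k b)
    have shift: "Poly_Mapping.single (m - Poly_Mapping.single i 1 + k) (c * of_nat (Poly_Mapping.lookup m i))
        = Poly_Mapping.single (m + k - Poly_Mapping.single i 1) (c * of_nat (Poly_Mapping.lookup m i))"
      for i c and m k :: "'a \<Rightarrow>\<^sub>0 nat"
    proof (cases "Poly_Mapping.lookup m i = 0")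
      case False
      then have "m - Poly_Mapping.single i 1 + k = m + k - Poly_Mapping.single i 1"
        by (intro poly_mapping_eqI) (auto simp: lookup_add lookup_minus lookup_single when_def)
      then show ?thesis by simp
    qed simp
    have "g i * Poly_Mapping.single (m + k - Poly_Mapping.single i 1)
          (a * b * of_nat (Poly_Mapping.lookup (m + k) i)) =
        g i * Poly_Mapping.single (m - Poly_Mapping.single i 1) (a * of_nat (Poly_Mapping.lookup m i)) *
          Poly_Mapping.single k b +
        Poly_Mapping.single m a *
          (g i * Poly_Mapping.single (k - Poly_Mapping.single i 1) (b * of_nat (Poly_Mapping.lookup k i)))" for i
      using shift[of m i k "a * b"] shift[of k i m "a * b"]
      by (simp add: mult_single lookup_add distrib_left single_add mult_ac add_ac mult.left_commute[of _ "g i"])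
    then show ?case
      by (simp add: mult_single derivation_of_monomial sum_distrib_left sum_distrib_right flip: sum.distrib)
  qed (simp add: distrib_left derivation_of_add algebra_simps)
qed (simp add: distrib_right derivation_of_add algebra_simps)

lemma is_derivation_derivation_of: "is_derivation (derivation_of g)"
proof -
  have "derivation_of g (Const c) = 0" for c
    by (simp add: Const_def derivation_of_monomial)
  then show ?thesis
    by (simp add: is_derivation_def derivation_of_add derivation_of_mult)
qed

lemma derivation_of_Var [simp]: "derivation_of g (Var i) = g i"
proof -
  have "derivation_of g (Var i) = (\<Sum>j\<in>UNIV. if j = i then g j else 0)"
    unfolding Var_def derivation_of_monomial
    by (rule sum.cong) (auto simp: lookup_single)
  then show ?thesis by simp
qed

lemma derivation_simps:
  assumes "is_derivation \<theta>"
  shows "\<theta> (p + q) = \<theta> p + \<theta> q" "\<theta> (Const c * p) = Const c * \<theta> p" "\<theta> (p * q) = \<theta> p * q + p * \<theta> q"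
  using assms unfolding is_derivation_def by blast+

text \<open>The difference of the two sides is a derivation that kills all variables. By the product rule it
  kills all monomials.\<close>

lemma derivation_eq_derivation_of:
  fixes \<theta> :: "'v::finite mpoly \<Rightarrow> 'v mpoly"
  assumes "is_derivation \<theta>"
  shows "\<theta> = derivation_of (\<lambda>i. \<theta> (Var i))"
proof
  fix p
  define \<delta> where "\<delta> p = \<theta> p - derivation_of (\<lambda>i. \<theta> (Var i)) p" for p
  have "is_derivation \<delta>"
    unfolding is_derivation_def
  proof (intro conjI allI)
    fix p q c
    let ?D = "derivation_of (\<lambda>i. \<theta> (Var i))"
    note \<theta> = derivation_simps[OF assms] and D = derivation_simps[OF is_derivation_derivation_of]
    show "\<delta> (p + q) = \<delta> p + \<delta> q"
      unfolding \<delta>_def \<theta>(1) D(1) by simp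
    show "\<delta> (Const c * p) = Const c * \<delta> p"
      unfolding \<delta>_def \<theta>(2) D(2) by (rule right_diff_distrib[symmetric])
    show "\<delta> (p * q) = \<delta> p * q + p * \<delta> q"
      unfolding \<delta>_def \<theta>(3) D(3) by (simp add: algebra_simps)
  qed
  note d = derivation_simps[OF this]
  have one: "\<delta> 1 = 0"
    using d(3)[of 1 1] by simp
  have pow: "\<delta> (Var i ^ k) = 0" for i k
    by (induction k) (simp_all add: one d(3), simp add: \<delta>_def)
  have prod: "\<delta> (\<Prod>i\<in>I. Var i ^ k i) = 0" if "finite I" for I k
    using that by (induction I) (simp_all add: one d(3) pow)
  have monomial: "\<delta> (Poly_Mapping.single m c) = 0" for m c
    unfolding monomial_eq_prod d(2) by (simp add: prod)
  have "\<delta> p = 0"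
    by (induction p rule: mpoly_induct) (simp_all add: d(1) monomial)
  then show "\<theta> p = derivation_of (\<lambda>i. \<theta> (Var i)) p"
    by (simp add: \<delta>_def)
qed

section \<open>Graded isomorphisms and extension of scalars\<close>

lemma graded_isomorphicI:
  assumes "bij_betw \<phi> (carrier M) (carrier N)"
    and "\<And>x y. x \<in> carrier M \<Longrightarrow> y \<in> carrier M \<Longrightarrow> \<phi> (x \<oplus>\<^bsub>M\<^esub> y) = \<phi> x \<oplus>\<^bsub>N\<^esub> \<phi> y"
    and "\<And>a x. x \<in> carrier M \<Longrightarrow> \<phi> (a \<odot>\<^bsub>M\<^esub> x) = a \<odot>\<^bsub>N\<^esub> \<phi> x"
    and "\<And>d. \<phi> ` component M d = component N d"
  shows "graded_isomorphic M N"
  using assms unfolding graded_isomorphic_def by blast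

lemma graded_isomorphic_trans:
  assumes "graded_isomorphic M N" "graded_isomorphic N P"
  shows "graded_isomorphic M P"
proof -
  obtain \<phi> where \<phi>: "bij_betw \<phi> (carrier M) (carrier N)"
      "\<forall>x \<in> carrier M. \<forall>y \<in> carrier M. \<phi> (x \<oplus>\<^bsub>M\<^esub> y) = \<phi> x \<oplus>\<^bsub>N\<^esub> \<phi> y"
      "\<forall>a. \<forall>x \<in> carrier M. \<phi> (a \<odot>\<^bsub>M\<^esub> x) = a \<odot>\<^bsub>N\<^esub> \<phi> x" "\<forall>d. \<phi> ` component M d = component N d"
    using assms(1) unfolding graded_isomorphic_def by blast
  obtain \<psi> where \<psi>: "bij_betw \<psi> (carrier N) (carrier P)"
      "\<forall>x \<in> carrier N. \<forall>y \<in> carrier N. \<psi> (x \<oplus>\<^bsub>N\<^esub> y) = \<psi> x \<oplus>\<^bsub>P\<^esub> \<psi> y"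
      "\<forall>a. \<forall>x \<in> carrier N. \<psi> (a \<odot>\<^bsub>N\<^esub> x) = a \<odot>\<^bsub>P\<^esub> \<psi> x" "\<forall>d. \<psi> ` component N d = component P d"
    using assms(2) unfolding graded_isomorphic_def by blast
  have "\<phi> x \<in> carrier N" if "x \<in> carrier M" for x
    using \<phi>(1) that by (rule bij_betw_apply)
  then show ?thesis
    using \<phi>(2-4) \<psi>(2-4) bij_betw_trans[OF \<phi>(1) \<psi>(1)]
    by (intro graded_isomorphicI[where \<phi> = "\<psi> \<circ> \<phi>"]) (simp_all flip: image_image)
qed

text \<open>The rules of calculation for the tensor product of \<open>M\<close> with the polynomial ring along \<open>h\<close>. The
  closure assumptions are what makes the bilinearity relations elements of the free abelian group;
  they hold in every module.\<close>

locale scalar_extension =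
  fixes h :: "'r \<Rightarrow> 's::finite mpoly" and M :: "('r, 'm) graded_module"
  assumes add_closed: "x \<in> carrier M \<Longrightarrow> y \<in> carrier M \<Longrightarrow> x \<oplus>\<^bsub>M\<^esub> y \<in> carrier M"
    and smult_closed: "x \<in> carrier M \<Longrightarrow> r \<odot>\<^bsub>M\<^esub> x \<in> carrier M"
begin

abbreviation "F \<equiv> tensor_free M"
abbreviation "H \<equiv> tensor_subgroup h M"
abbreviation "T \<equiv> tensor_group h M"

definition cls :: "(('m \<times> 's mpoly) \<Rightarrow>\<^sub>0 int) \<Rightarrow> (('m \<times> 's mpoly) \<Rightarrow>\<^sub>0 int) set" where
  "cls c = H #>\<^bsub>F\<^esub> c"

lemma F_simps [simp]:
  "c \<in> carrier F \<longleftrightarrow> Poly_Mapping.keys c \<subseteq> carrier M \<times> UNIV"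
  "c \<otimes>\<^bsub>F\<^esub> d = c + d" "\<one>\<^bsub>F\<^esub> = 0" "Poly_Mapping.keys c \<subseteq> carrier M \<times> UNIV \<Longrightarrow> inv\<^bsub>F\<^esub> c = - c"
  by (simp_all add: tensor_free_def)

lemma comm_group_F: "comm_group F"
  unfolding tensor_free_def by (rule abelian_free_Abelian_group)

lemma group_F: "group F"
  using comm_group_F by (rule comm_group.axioms)

lemma tensor_relations_intros:
  "x \<in> carrier M \<Longrightarrow> y \<in> carrier M \<Longrightarrow>
     frag_of (x \<oplus>\<^bsub>M\<^esub> y, s) - frag_of (x, s) - frag_of (y, s) \<in> tensor_relations h M"
  "x \<in> carrier M \<Longrightarrow> frag_of (x, s + t) - frag_of (x, s) - frag_of (x, t) \<in> tensor_relations h M"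
  "x \<in> carrier M \<Longrightarrow> frag_of (r \<odot>\<^bsub>M\<^esub> x, s) - frag_of (x, h r * s) \<in> tensor_relations h M"
  unfolding tensor_relations_def by blast+

lemma tensor_relations_cases:
  assumes "c \<in> tensor_relations h M"
  obtains (add_left) x y s where "x \<in> carrier M" "y \<in> carrier M"
      "c = frag_of (x \<oplus>\<^bsub>M\<^esub> y, s) - frag_of (x, s) - frag_of (y, s)"
    | (add_right) x s t where "x \<in> carrier M" "c = frag_of (x, s + t) - frag_of (x, s) - frag_of (x, t)"
    | (smult) r x s where "x \<in> carrier M" "c = frag_of (r \<odot>\<^bsub>M\<^esub> x, s) - frag_of (x, h r * s)"
  using assms unfolding tensor_relations_def by blast

lemma relations_closed: "tensor_relations h M \<subseteq> carrier F"
proof -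
  have diff: "a - b \<in> carrier F" if "a \<in> carrier F" "b \<in> carrier F" for a b
    using that keys_diff[of a b] by auto
  have gen: "frag_of (x, s) \<in> carrier F" if "x \<in> carrier M" for x s
    using that by simp
  show ?thesis
    unfolding tensor_relations_def by (auto intro!: diff gen add_closed smult_closed simp del: F_simps)
qed

lemma subgroup_H: "subgroup H F"
  unfolding tensor_subgroup_def by (rule group.generate_is_subgroup[OF group_F relations_closed])

lemma normal_H: "H \<lhd> F"
  by (rule comm_group.subgroup_imp_normal[OF comm_group_F subgroup_H])

lemma H_closed:
  "0 \<in> H" "c \<in> H \<Longrightarrow> d \<in> H \<Longrightarrow> c + d \<in> H" "c \<in> H \<Longrightarrow> - c \<in> H"
proof -
  have 1: "c \<in> H \<Longrightarrow> c \<in> carrier F" for c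
    by (rule subgroup.mem_carrier[OF subgroup_H])
  show "0 \<in> H"
    using subgroup.one_closed[OF subgroup_H] by simp
  show "c \<in> H \<Longrightarrow> d \<in> H \<Longrightarrow> c + d \<in> H" for c d
    using subgroup.m_closed[OF subgroup_H] by simp
  show "c \<in> H \<Longrightarrow> - c \<in> H" for c
    using subgroup.m_inv_closed[OF subgroup_H, of c] 1[of c] by simp
qed

lemma relation_in_H: "c \<in> tensor_relations h M \<Longrightarrow> c \<in> H"
  unfolding tensor_subgroup_def by (rule generate.incl)

lemma H_induct [consumes 1, case_names zero relation uminus add]:
  assumes "c \<in> H" "P 0" "\<And>c. c \<in> tensor_relations h M \<Longrightarrow> P c"
    "\<And>c. c \<in> H \<Longrightarrow> P c \<Longrightarrow> P (- c)" "\<And>c d. c \<in> H \<Longrightarrow> d \<in> H \<Longrightarrow> P c \<Longrightarrow> P d \<Longrightarrow> P (c + d)"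
  shows "P c"
  using assms(1) unfolding tensor_subgroup_def
proof (induction rule: generate.induct)
  case one show ?case by (simp add: assms(2))
next
  case (incl c) then show ?case by (rule assms(3))
next
  case (inv c)
  then have "inv\<^bsub>F\<^esub> c = - c"
    using relations_closed by (intro F_simps(4)) (auto simp flip: F_simps(1))
  then show ?case
    using inv assms(3,4) relation_in_H by simp
next
  case (eng c d) then show ?case
    by (simp add: assms(5) flip: tensor_subgroup_def)
qed

lemma cls_eq_image: "cls c = (\<lambda>d. d + c) ` H"
  by (auto simp: cls_def r_coset_def)

lemma cls_eq_iff: "cls c = cls d \<longleftrightarrow> c - d \<in> H"
proof
  assume "cls c = cls d"
  moreover have "0 + c \<in> cls c"
    unfolding cls_eq_image using H_closed(1) by (rule imageI)
  ultimately show "c - d \<in> H"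
    by (auto simp: cls_eq_image)
next
  assume *: "c - d \<in> H"
  have "cls c \<subseteq> cls d" if "c - d \<in> H" for c d
  proof
    fix x assume "x \<in> cls c"
    then obtain y where "x = y + c" "y \<in> H" by (auto simp: cls_eq_image)
    then have "x = (y + (c - d)) + d" "y + (c - d) \<in> H"
      using that H_closed(2) by auto
    then show "x \<in> cls d"
      unfolding cls_eq_image by (rule image_eqI)
  qed
  from this[OF *] this[of d c] show "cls c = cls d"
    using H_closed(3)[OF *] by auto
qed

lemma carrier_T: "carrier T = cls ` carrier F"
  by (auto simp: tensor_group_def FactGroup_def RCOSETS_def cls_def)

lemma mult_cls: "c \<in> carrier F \<Longrightarrow> d \<in> carrier F \<Longrightarrow> cls c \<otimes>\<^bsub>T\<^esub> cls d = cls (c + d)"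
  using normal.rcos_sum[OF normal_H, of c d] by (simp add: tensor_group_def FactGroup_def cls_def)

lemma one_T: "\<one>\<^bsub>T\<^esub> = cls 0"
  by (simp add: tensor_group_def FactGroup_def cls_eq_image)

lemma group_T: "group T"
  unfolding tensor_group_def by (rule normal.factorgroup_is_group[OF normal_H])

lemma inv_cls:
  assumes "c \<in> carrier F" shows "inv\<^bsub>T\<^esub> (cls c) = cls (- c)"
proof -
  have "- c \<in> carrier F" using assms by simp
  with assms show ?thesis
    by (intro group.inv_equality[OF group_T]) (auto simp: mult_cls one_T carrier_T)
qed

lemma pure_tensor_eq_cls: "pure_tensor h M x s = cls (frag_of (x, s))"
  by (simp add: pure_tensor_def cls_def)

lemma pure_tensor_add_left:
  assumes "x \<in> carrier M" "y \<in> carrier M"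
  shows "pure_tensor h M (x \<oplus>\<^bsub>M\<^esub> y) s = pure_tensor h M x s \<otimes>\<^bsub>T\<^esub> pure_tensor h M y s"
proof -
  have "frag_of (x \<oplus>\<^bsub>M\<^esub> y, s) - frag_of (x, s) - frag_of (y, s) \<in> H"
    by (intro relation_in_H tensor_relations_intros assms)
  then show ?thesis
    using assms by (simp add: pure_tensor_eq_cls mult_cls cls_eq_iff diff_diff_eq)
qed

lemma pure_tensor_zero_right:
  assumes "x \<in> carrier M"
  shows "pure_tensor h M x 0 = \<one>\<^bsub>T\<^esub>"
proof -
  have "frag_of (x, 0 + 0) - frag_of (x, 0) - frag_of (x, 0) \<in> H"
    by (intro relation_in_H tensor_relations_intros assms)
  then have "frag_of (x, 0) \<in> H"
    using H_closed(3)[of "- frag_of (x, 0)"] by simp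
  then show ?thesis
    by (simp add: pure_tensor_eq_cls one_T cls_eq_iff)
qed

lemma pure_tensor_smult:
  assumes "x \<in> carrier M"
  shows "pure_tensor h M (r \<odot>\<^bsub>M\<^esub> x) s = pure_tensor h M x (h r * s)"
proof -
  have "frag_of (r \<odot>\<^bsub>M\<^esub> x, s) - frag_of (x, h r * s) \<in> H"
    by (intro relation_in_H tensor_relations_intros assms)
  then show ?thesis
    by (simp add: pure_tensor_eq_cls cls_eq_iff)
qed

text \<open>Multiplication by \<open>a\<close> on the free abelian group maps each bilinearity relation to another one, so
  it preserves the subgroup \<open>H\<close> of relations and acts on the cosets.\<close>

lemma smult_pure_tensor:
  "a \<odot>\<^bsub>extend_scalars h M\<^esub> pure_tensor h M x s = pure_tensor h M x (a * s)"
proof -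
  define \<mu> :: "(('m \<times> 's mpoly) \<Rightarrow>\<^sub>0 int) \<Rightarrow> (('m \<times> 's mpoly) \<Rightarrow>\<^sub>0 int)"
    where "\<mu> = frag_extend (\<lambda>(x, s). frag_of (x, a * s))"
  have \<mu>_H: "\<mu> c \<in> H" if "c \<in> H" for c
    using that
  proof (induction rule: H_induct)
    case (relation c)
    then have "\<mu> c \<in> tensor_relations h M"
    proof (cases rule: tensor_relations_cases)
      case (add_left x y s)
      then show ?thesis
        using tensor_relations_intros(1)[of x y "a * s"] by (simp add: \<mu>_def frag_extend_diff)
    next
      case (add_right x s t)
      then show ?thesis
        using tensor_relations_intros(2)[of x "a * s" "a * t"]
        by (simp add: \<mu>_def frag_extend_diff distrib_left)
    next
      case (smult r x s)
      then show ?thesis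
        using tensor_relations_intros(3)[of x r "a * s"]
        by (simp add: \<mu>_def frag_extend_diff mult.left_commute[of a])
    qed
    then show ?case by (rule relation_in_H)
  qed (simp_all add: \<mu>_def frag_extend_add frag_extend_minus H_closed)
  have "H <#>\<^bsub>F\<^esub> \<mu> ` cls (frag_of (x, s)) = cls (\<mu> (frag_of (x, s)))"
  proof (intro equalityI subsetI)
    fix y assume "y \<in> H <#>\<^bsub>F\<^esub> \<mu> ` cls (frag_of (x, s))"
    then obtain k k' where "y = k + \<mu> (k' + frag_of (x, s))" "k \<in> H" "k' \<in> H"
      by (auto simp: set_mult_def cls_eq_image)
    then have "y = (k + \<mu> k') + \<mu> (frag_of (x, s))" "k + \<mu> k' \<in> H"
      using H_closed(2) \<mu>_H by (auto simp: \<mu>_def frag_extend_add)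
    then show "y \<in> cls (\<mu> (frag_of (x, s)))"
      unfolding cls_eq_image by (rule image_eqI)
  next
    fix y assume "y \<in> cls (\<mu> (frag_of (x, s)))"
    then obtain k where "y = k + \<mu> (0 + frag_of (x, s))" "k \<in> H"
      by (auto simp: cls_eq_image)
    then show "y \<in> H <#>\<^bsub>F\<^esub> \<mu> ` cls (frag_of (x, s))"
      using H_closed(1) unfolding set_mult_def cls_eq_image by fastforce
  qed
  then show ?thesis
    by (simp add: extend_scalars_def pure_tensor_eq_cls \<mu>_def)
qed

end

section \<open>Setting the last variable to zero\<close>

text \<open>The image of the variable with index \<open>a\<close> under the specialization.\<close>

definition coord :: "'n::finite option \<Rightarrow> 'n mpoly" where
  "coord = case_option 0 Var"

lemma coord_simps [simp]: "coord None = 0" "coord (Some i) = Var i"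
  by (simp_all add: coord_def)

text \<open>A section of the specialization that turns \<open>coord a - coord b\<close> into \<open>Var a - Var b\<close>, because
  it sends \<open>coord a\<close> to \<open>Var a - Var None\<close> for all \<open>a\<close>. The inclusion of the polynomial ring in the
  bigger one, which is the obvious section, does not respect these differences.\<close>

definition translate :: "'n::finite mpoly \<Rightarrow> 'n option mpoly" where
  "translate = substitute Const (\<lambda>i. Var (Some i) - Var None)"

lemma specialize_ring_morphism: "ring_morphism specialize"
  unfolding specialize_def[abs_def] by (rule substitute_ring_morphism[OF Const_ring_morphism])

lemma translate_ring_morphism: "ring_morphism translate"
  unfolding translate_def by (rule substitute_ring_morphism[OF Const_ring_morphism])

lemma specialize_simps [simp]: "specialize (Const c) = Const c" "specialize (Var a) = coord a"
  by (simp_all add: specialize_def coord_def Const_ring_morphism)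

lemma translate_simps [simp]:
  "translate (Const c) = Const c" "translate (Var i) = Var (Some i) - Var None"
  by (simp_all add: translate_def Const_ring_morphism)

lemma translate_coord: "translate (coord a) = Var a - Var None"
  by (cases a) (simp_all add: ring_morphism_0[OF translate_ring_morphism])

lemma specialize_translate: "specialize (translate p) = p"
  by (rule ring_morphism_unique[of "\<lambda>p. specialize (translate p)"])
    (simp_all add: ring_morphism_comp[OF translate_ring_morphism specialize_ring_morphism]
      ring_morphism_id ring_morphism_diff[OF specialize_ring_morphism])

text \<open>The composition of specialization and translation replaces \<open>Var a\<close> by \<open>Var a - Var None\<close>.\<close>

lemma Var_None_dvd: "Var None dvd p - translate (specialize p)"
proof -
  have "translate (specialize p) = substitute Const (\<lambda>a. Var a - Var None) p"
    by (rule ring_morphism_unique[of "\<lambda>p. translate (specialize p)"])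
      (simp_all add: ring_morphism_comp[OF specialize_ring_morphism translate_ring_morphism]
        substitute_ring_morphism Const_ring_morphism translate_coord)
  then show ?thesis
    using dvd_diff_substitute[of "Var None" "\<lambda>a. Var a - Var None" p] by simp
qed

lemma homogeneous_translate: "homogeneous d p \<Longrightarrow> homogeneous d (translate p)"
  unfolding translate_def
  using homogeneous_add[OF homogeneous_Var homogeneous_uminus[OF homogeneous_Var]]
  by (intro homogeneous_substitute) simp_all

lemma homogeneous_specialize: "homogeneous d p \<Longrightarrow> homogeneous d (specialize p)"
  unfolding specialize_def
  by (intro homogeneous_substitute) (simp_all add: homogeneous_Var[simplified] split: option.split)

text \<open>A polynomial is divisible by \<open>Var a - Var b\<close> exactly if identifying the two variables makes it
  zero. Under this identification \<open>Var c\<close> becomes a variable again, which is not a zero divisor.\<close>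

lemma Var_diff_dvd_cancel_Var:
  assumes "a \<noteq> b" and dvd: "(Var a - Var b) dvd Var c * (p :: 'v::finite mpoly)"
  shows "(Var a - Var b) dvd p"
proof -
  define \<sigma> :: "'v mpoly \<Rightarrow> 'v mpoly" where "\<sigma> = substitute Const (Var(a := Var b))"
  have \<sigma>: "ring_morphism \<sigma>"
    unfolding \<sigma>_def by (rule substitute_ring_morphism[OF Const_ring_morphism])
  have \<sigma>_Var: "\<sigma> (Var i) = (if i = a then Var b else Var i)" for i
    by (simp add: \<sigma>_def Const_ring_morphism)
  have "\<sigma> (Var a - Var b) = 0"
    using assms(1) by (simp add: ring_morphism_diff[OF \<sigma>] \<sigma>_Var)
  then have "\<sigma> (Var c) * \<sigma> p = 0"
    using ring_morphism_dvd[OF \<sigma> dvd] by (simp add: ring_morphism_simps[OF \<sigma>])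
  then have "\<sigma> p = 0"
    unfolding \<sigma>_Var by (metis Var_mult_eq_0)
  moreover have "(Var a - Var b) dvd p - \<sigma> p"
    unfolding \<sigma>_def by (rule dvd_diff_substitute) simp
  ultimately show ?thesis by simp
qed

section \<open>Logarithmic derivations of the braid arrangement\<close>

lemma derivation_diff: "is_derivation \<theta> \<Longrightarrow> \<theta> (p - q) = \<theta> p - \<theta> q"
  unfolding is_derivation_def by (metis add_diff_cancel_right' diff_add_cancel)

lemma log_derivationsI:
  assumes "is_derivation \<theta>" "\<And>a b. (Var a - Var b) dvd \<theta> (Var a) - \<theta> (Var b)"
  shows "\<theta> \<in> log_derivations"
  using assms by (simp add: log_derivations_def derivation_diff)

lemma log_derivationsD:
  assumes "\<theta> \<in> log_derivations"
  shows "is_derivation \<theta>" "(Var a - Var b) dvd \<theta> (Var a) - \<theta> (Var b)"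
proof -
  show \<theta>: "is_derivation \<theta>"
    using assms by (simp add: log_derivations_def)
  show "(Var a - Var b) dvd \<theta> (Var a) - \<theta> (Var b)"
    using assms by (cases "a = b") (auto simp: log_derivations_def simp flip: derivation_diff[OF \<theta>])
qed

lemma is_derivation_add:
  assumes "is_derivation \<theta>" "is_derivation \<eta>"
  shows "is_derivation (\<lambda>p. \<theta> p + \<eta> p)"
  unfolding is_derivation_def
proof (intro conjI allI)
  note \<theta> = derivation_simps[OF assms(1)] and \<eta> = derivation_simps[OF assms(2)]
  fix p q c
  show "\<theta> (p + q) + \<eta> (p + q) = \<theta> p + \<eta> p + (\<theta> q + \<eta> q)"
    by (simp add: \<theta>(1) \<eta>(1))
  show "\<theta> (Const c * p) + \<eta> (Const c * p) = Const c * (\<theta> p + \<eta> p)"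
    by (simp add: \<theta>(2) \<eta>(2) distrib_left)
  show "\<theta> (p * q) + \<eta> (p * q) = (\<theta> p + \<eta> p) * q + p * (\<theta> q + \<eta> q)"
    by (simp add: \<theta>(3) \<eta>(3) algebra_simps)
qed

lemma is_derivation_smult:
  assumes "is_derivation \<theta>"
  shows "is_derivation (\<lambda>p. a * \<theta> p)"
  unfolding is_derivation_def
proof (intro conjI allI)
  note \<theta> = derivation_simps[OF assms]
  fix p q c
  show "a * \<theta> (p + q) = a * \<theta> p + a * \<theta> q"
    by (simp add: \<theta>(1) distrib_left)
  show "a * \<theta> (Const c * p) = Const c * (a * \<theta> p)"
    by (simp add: \<theta>(2) mult.left_commute)
  show "a * \<theta> (p * q) = a * \<theta> p * q + p * (a * \<theta> q)"
    by (simp add: \<theta>(3) algebra_simps)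
qed

lemma derivation_eqI:
  fixes \<theta> \<eta> :: "'v::finite mpoly \<Rightarrow> 'v mpoly"
  assumes "is_derivation \<theta>" "is_derivation \<eta>" "\<And>i. \<theta> (Var i) = \<eta> (Var i)"
  shows "\<theta> = \<eta>"
  using derivation_eq_derivation_of[OF assms(1)] derivation_eq_derivation_of[OF assms(2)] assms(3)
  by simp

lemma log_derivations_add:
  assumes "\<theta> \<in> log_derivations" "\<eta> \<in> log_derivations"
  shows "(\<lambda>p. \<theta> p + \<eta> p) \<in> log_derivations"
  using assms dvd_add[OF log_derivationsD(2)[OF assms(1)] log_derivationsD(2)[OF assms(2)]]
  by (intro log_derivationsI is_derivation_add) (auto dest: log_derivationsD simp: add_diff_add)

lemma log_derivations_smult:
  assumes "\<theta> \<in> log_derivations"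
  shows "(\<lambda>p. a * \<theta> p) \<in> log_derivations"
  using assms by (intro log_derivationsI is_derivation_smult)
    (auto intro: log_derivationsD dvd_mult simp flip: right_diff_distrib)

interpretation braid: scalar_extension specialize log_module
  by unfold_locales (simp_all add: log_module_def log_derivations_add log_derivations_smult)

section \<open>Splines on the complete graph\<close>

text \<open>Tuples indexed by the vertices of the complete graph on \<open>n + 1\<close> vertices, with one divisibility
  condition for each edge. Piecewise polynomials on either fan and logarithmic derivations both
  reduce to such tuples.\<close>

definition braid_splines :: "('n::finite mpoly, 'n option \<Rightarrow> 'n mpoly) graded_module" where
  "braid_splines =
     \<lparr>carrier = {F. \<forall>a b. (coord a - coord b) dvd F a - F b},
      monoid.mult = undefined,
      one = undefined,
      zero = (\<lambda>a. 0),
      add = (\<lambda>F G a. F a + G a),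
      smult = (\<lambda>s F a. s * F a),
      component = (\<lambda>d. {F. (\<forall>a b. (coord a - coord b) dvd F a - F b) \<and> (\<forall>a. homogeneous d (F a))})\<rparr>"

definition spline_derivation :: "('n::finite option \<Rightarrow> 'n mpoly) \<Rightarrow> 'n option mpoly \<Rightarrow> 'n option mpoly" where
  "spline_derivation F = derivation_of (\<lambda>a. translate (F a))"

lemma spline_derivation_Var [simp]: "spline_derivation F (Var a) = translate (F a)"
  by (simp add: spline_derivation_def)

lemma is_derivation_spline_derivation: "is_derivation (spline_derivation F)"
  by (simp add: spline_derivation_def is_derivation_derivation_of)

lemma spline_derivation_log:
  assumes "F \<in> carrier braid_splines"
  shows "spline_derivation F \<in> log_derivations"
proof (rule log_derivationsI[OF is_derivation_spline_derivation])
  fix a b :: "'a option"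
  have "translate (coord a - coord b) dvd translate (F a - F b)"
    using assms by (intro ring_morphism_dvd[OF translate_ring_morphism]) (simp add: braid_splines_def)
  then show "(Var a - Var b) dvd spline_derivation F (Var a) - spline_derivation F (Var b)"
    by (simp add: ring_morphism_diff[OF translate_ring_morphism] translate_coord)
qed

text \<open>The isomorphism: a spline is translated to the coefficients of a logarithmic derivation, and this
  derivation is tensored with \<open>1\<close>.\<close>

definition spline_tensor ::
    "('n::finite option \<Rightarrow> 'n mpoly) \<Rightarrow> ((('n option mpoly \<Rightarrow> 'n option mpoly) \<times> 'n mpoly) \<Rightarrow>\<^sub>0 int) set" where
  "spline_tensor F = pure_tensor specialize log_module (spline_derivation F) 1"

lemma specialize_log_derivation:
  assumes "\<theta> \<in> log_derivations"
  shows "(\<lambda>a. s * specialize (\<theta> (Var a))) \<in> carrier braid_splines"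
proof -
  have "specialize (Var a - Var b) dvd specialize (\<theta> (Var a) - \<theta> (Var b))" for a b
    by (intro ring_morphism_dvd[OF specialize_ring_morphism] log_derivationsD[OF assms])
  then show ?thesis
    by (auto simp: braid_splines_def ring_morphism_diff[OF specialize_ring_morphism] simp flip: right_diff_distrib)
qed

lemma carrier_log_module: "carrier log_module = log_derivations"
  by (simp add: log_module_def)

text \<open>Moving \<open>s\<close> to the left factor gives a tensor \<open>\<eta> \<otimes> 1\<close>. The coefficients of \<open>\<eta>\<close> and of the
  derivation that belongs to its specialization \<open>F\<close> agree modulo \<open>Var None\<close>, and the quotient \<open>\<xi>\<close> of
  their difference by \<open>Var None\<close> is logarithmic again. Hence the difference contributes
  \<open>Var None \<cdot> \<xi> \<otimes> 1 = \<xi> \<otimes> 0 = 0\<close>. The lemma is the source of surjectivity, and of the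
  description of the graded components.\<close>

lemma pure_tensor_eq_spline_tensor:
  assumes "\<theta> \<in> log_derivations"
  shows "pure_tensor specialize log_module \<theta> s = spline_tensor (\<lambda>a. s * specialize (\<theta> (Var a)))"
proof -
  define \<eta> where "\<eta> p = translate s * \<theta> p" for p
  define F where "F a = s * specialize (\<theta> (Var a))" for a
  have \<eta>: "\<eta> \<in> log_derivations"
    unfolding \<eta>_def[abs_def] by (rule log_derivations_smult[OF assms])
  have F: "F \<in> carrier braid_splines"
    unfolding F_def[abs_def] by (rule specialize_log_derivation[OF assms])
  have F_\<eta>: "F a = specialize (\<eta> (Var a))" for a
    by (simp add: F_def \<eta>_def ring_morphism_simps[OF specialize_ring_morphism] specialize_translate)
  have "\<forall>a. \<exists>q. \<eta> (Var a) - translate (F a) = Var None * q"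
    using Var_None_dvd unfolding F_\<eta> dvd_def by blast
  then obtain g where g: "\<eta> (Var a) - translate (F a) = Var None * g a" for a
    by metis
  define \<xi> where "\<xi> = derivation_of g"
  have \<xi>: "\<xi> \<in> log_derivations"
  proof (rule log_derivationsI)
    fix a b :: "'a option"
    have "(Var a - Var b) dvd
        (\<eta> (Var a) - \<eta> (Var b)) - (spline_derivation F (Var a) - spline_derivation F (Var b))"
      by (intro dvd_diff log_derivationsD \<eta> spline_derivation_log F)
    also have "\<dots> = (\<eta> (Var a) - translate (F a)) - (\<eta> (Var b) - translate (F b))"
      by simp
    also have "\<dots> = Var None * (g a - g b)"
      by (simp only: g right_diff_distrib)
    finally have "(Var a - Var b) dvd g a - g b"
      by (cases "a = b") (auto dest: Var_diff_dvd_cancel_Var)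
    then show "(Var a - Var b) dvd \<xi> (Var a) - \<xi> (Var b)"
      by (simp add: \<xi>_def)
  qed (simp add: \<xi>_def is_derivation_derivation_of)
  have "\<eta> = (\<lambda>p. spline_derivation F p + Var None * \<xi> p)"
    using g by (intro derivation_eqI is_derivation_add is_derivation_smult is_derivation_spline_derivation
        log_derivationsD \<eta> \<xi>) (simp_all add: \<xi>_def algebra_simps flip: g)
  then have \<eta>_eq: "\<eta> = spline_derivation F \<oplus>\<^bsub>log_module\<^esub> (Var None \<odot>\<^bsub>log_module\<^esub> \<xi>)"
    by (simp add: log_module_def)
  note carr = spline_derivation_log[OF F, folded carrier_log_module] \<xi>[folded carrier_log_module]
    assms[folded carrier_log_module]
  have "pure_tensor specialize log_module \<theta> s = pure_tensor specialize log_module \<eta> 1"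
    using braid.pure_tensor_smult[OF carr(3), of "translate s" 1]
    by (simp add: specialize_translate log_module_def \<eta>_def[abs_def])
  also have "\<dots> = spline_tensor F \<otimes>\<^bsub>braid.T\<^esub> pure_tensor specialize log_module (Var None \<odot>\<^bsub>log_module\<^esub> \<xi>) 1"
    unfolding \<eta>_eq spline_tensor_def by (intro braid.pure_tensor_add_left carr braid.smult_closed)
  also have "pure_tensor specialize log_module (Var None \<odot>\<^bsub>log_module\<^esub> \<xi>) 1 = \<one>\<^bsub>braid.T\<^esub>"
    by (simp add: braid.pure_tensor_smult carr braid.pure_tensor_zero_right)
  also have "spline_tensor F \<otimes>\<^bsub>braid.T\<^esub> \<one>\<^bsub>braid.T\<^esub> = spline_tensor F"
    using carr(1) by (intro monoid.r_one group.is_monoid braid.group_T)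
      (auto simp: braid.carrier_T spline_tensor_def braid.pure_tensor_eq_cls)
  finally show ?thesis
    by (simp add: F_def[abs_def])
qed

lemma spline_tensor_add:
  assumes "F \<in> carrier braid_splines" "G \<in> carrier braid_splines"
  shows "spline_tensor (\<lambda>a. F a + G a) = spline_tensor F \<otimes>\<^bsub>braid.T\<^esub> spline_tensor G"
proof -
  have "spline_derivation (\<lambda>a. F a + G a) = (\<lambda>p. spline_derivation F p + spline_derivation G p)"
    by (intro derivation_eqI is_derivation_add is_derivation_spline_derivation)
      (simp add: ring_morphism_simps[OF translate_ring_morphism])
  then have "spline_derivation (\<lambda>a. F a + G a) = spline_derivation F \<oplus>\<^bsub>log_module\<^esub> spline_derivation G"
    by (simp add: log_module_def)
  then show ?thesis
    using assms by (simp add: spline_tensor_def braid.pure_tensor_add_left carrier_log_module spline_derivation_log)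
qed

lemma spline_tensor_smult:
  assumes "F \<in> carrier braid_splines"
  shows "spline_tensor (\<lambda>a. s * F a) = s \<odot>\<^bsub>D_braid\<^esub> spline_tensor F"
  using pure_tensor_eq_spline_tensor[OF spline_derivation_log[OF assms], of s]
  by (simp add: D_braid_def spline_tensor_def braid.smult_pure_tensor specialize_translate)

text \<open>The additive map \<open>\<Psi>\<close> from the free abelian group, which sends \<open>(\<theta>, s)\<close> to \<open>s\<close> times the
  specialized coefficient of \<open>\<theta>\<close> at \<open>a\<close>, kills the bilinearity relations and therefore recovers \<open>F a\<close>
  from the tensor.\<close>

lemma spline_tensor_inj:
  assumes "spline_tensor F = spline_tensor G"
  shows "F = G"
proof
  fix a
  define \<Psi> where "\<Psi> c = (\<Sum>k\<in>Poly_Mapping.keys c.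
      of_int (Poly_Mapping.lookup c k) * (snd k * specialize (fst k (Var a))))"
    for c :: "(('a option mpoly \<Rightarrow> 'a option mpoly) \<times> 'a mpoly) \<Rightarrow>\<^sub>0 int"
  have add: "\<Psi> (c + d) = \<Psi> c + \<Psi> d" for c d
    unfolding \<Psi>_def by (rule setsum_keys_plus_distrib) (simp_all add: distrib_right)
  have uminus: "\<Psi> (- c) = - \<Psi> c" for c
    using add[of c "- c"] by (simp add: \<Psi>_def eq_neg_iff_add_eq_0 add.commute)
  have diff: "\<Psi> (c - d) = \<Psi> c - \<Psi> d" for c d
    using add[of c "- d"] uminus[of d] by simp
  have frag: "\<Psi> (frag_of (\<theta>, s)) = s * specialize (\<theta> (Var a))" for \<theta> s
    by (simp add: \<Psi>_def)
  have "\<Psi> c = 0" if "c \<in> braid.H" for c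
    using that
  proof (induction rule: braid.H_induct)
    case (relation c)
    then show ?case
      by (cases rule: braid.tensor_relations_cases)
        (auto simp: log_module_def diff frag distrib_left distrib_right mult_ac
            ring_morphism_simps[OF specialize_ring_morphism])
  qed (simp_all add: add uminus, simp add: \<Psi>_def)
  then have "\<Psi> (frag_of (spline_derivation F, 1) - frag_of (spline_derivation G, 1)) = 0"
    using assms by (simp add: spline_tensor_def braid.pure_tensor_eq_cls braid.cls_eq_iff)
  then show "F a = G a"
    by (simp add: diff frag specialize_translate)
qed

lemma braid_splines_closed:
  fixes F G :: "'n::finite option \<Rightarrow> 'n mpoly"
  assumes "F \<in> carrier braid_splines" "G \<in> carrier braid_splines"
  shows "(\<lambda>a. F a - G a) \<in> carrier braid_splines" "(\<lambda>a. F a + G a) \<in> carrier braid_splines"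
    "(\<lambda>a. - F a) \<in> carrier braid_splines"
proof -
  have *: "(coord a - coord b) dvd F a - F b" "(coord a - coord b) dvd G a - G b" for a b
    using assms by (auto simp: braid_splines_def)
  show "(\<lambda>a. F a - G a) \<in> carrier braid_splines"
    using dvd_diff[OF *] by (simp add: braid_splines_def algebra_simps)
  show "(\<lambda>a. F a + G a) \<in> carrier braid_splines"
    using dvd_add[OF *] by (simp add: braid_splines_def algebra_simps)
  show "(\<lambda>a. - F a) \<in> carrier braid_splines"
  proof -
    have "(coord a - coord b) dvd - (F a - F b)" for a b
      unfolding dvd_minus_iff by (rule *(1))
    then show ?thesis by (simp add: braid_splines_def)
  qed
qed

lemma spline_tensor_in_carrier:
  "F \<in> carrier braid_splines \<Longrightarrow> spline_tensor F \<in> carrier braid.T"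
  by (auto simp: spline_tensor_def braid.pure_tensor_eq_cls braid.carrier_T carrier_log_module spline_derivation_log)

lemma spline_tensor_zero: "spline_tensor (\<lambda>a. 0) = \<one>\<^bsub>braid.T\<^esub>"
proof -
  have zero: "(\<lambda>a. 0) \<in> carrier braid_splines"
    by (simp add: braid_splines_def)
  have "spline_tensor (\<lambda>a. 0) = spline_tensor (\<lambda>a. 0) \<otimes>\<^bsub>braid.T\<^esub> spline_tensor (\<lambda>a. 0)"
    using spline_tensor_add[OF zero zero] by simp
  then show ?thesis
    using group.l_cancel_one[OF braid.group_T] spline_tensor_in_carrier[OF zero] by metis
qed

lemma spline_tensor_uminus:
  assumes "F \<in> carrier braid_splines"
  shows "spline_tensor (\<lambda>a. - F a) = inv\<^bsub>braid.T\<^esub> (spline_tensor F)"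
  using spline_tensor_add[OF braid_splines_closed(3) assms, OF assms assms] assms
  by (intro group.inv_equality[symmetric, OF braid.group_T])
    (simp_all add: spline_tensor_zero spline_tensor_in_carrier braid_splines_closed)

lemma spline_tensor_surj:
  fixes C :: "((('n::finite option mpoly \<Rightarrow> 'n option mpoly) \<times> 'n mpoly) \<Rightarrow>\<^sub>0 int) set"
  assumes "C \<in> carrier braid.T"
  shows "C \<in> spline_tensor ` carrier braid_splines"
proof -
  obtain c where c: "C = braid.cls c" "Poly_Mapping.keys c \<subseteq> log_derivations \<times> UNIV"
    using assms by (auto simp: braid.carrier_T carrier_log_module)
  have "braid.cls c \<in> spline_tensor ` carrier braid_splines"
    using c(2)
  proof (induction c rule: free_Abelian_group_induct[consumes 1, case_names zero diff generator])
    case zero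
    show ?case
      unfolding braid.one_T[symmetric] spline_tensor_zero[symmetric]
      by (rule imageI) (simp add: braid_splines_def)
  next
    case (diff x y)
    then obtain F G where FG: "braid.cls x = spline_tensor F" "braid.cls y = spline_tensor G"
      "F \<in> carrier braid_splines" "G \<in> carrier braid_splines"
      by blast
    have xy: "x \<in> carrier braid.F" "y \<in> carrier braid.F" "- y \<in> carrier braid.F"
      using diff by (simp_all add: carrier_log_module)
    have "braid.cls (x - y) = braid.cls x \<otimes>\<^bsub>braid.T\<^esub> inv\<^bsub>braid.T\<^esub> (braid.cls y)"
      using braid.mult_cls[OF xy(1,3)] braid.inv_cls[OF xy(2)] by simp
    also have "\<dots> = spline_tensor (\<lambda>a. F a + - G a)"
      using FG spline_tensor_add[OF FG(3) braid_splines_closed(3)[OF FG(4) FG(4)]]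
      by (simp add: spline_tensor_uminus)
    finally show ?case
      using braid_splines_closed(1)[OF FG(3,4)] by simp
  next
    case (generator k)
    obtain \<theta> s where "k = (\<theta>, s)" "\<theta> \<in> log_derivations"
      using generator by auto
    then show ?case
      using pure_tensor_eq_spline_tensor[of \<theta> s] specialize_log_derivation[of \<theta> s]
      by (simp add: braid.pure_tensor_eq_cls)
  qed
  then show ?thesis by (simp add: c(1))
qed

lemma component_braid_splines:
  "component braid_splines d = {F \<in> carrier braid_splines. \<forall>a. homogeneous d (F a)}"
  by (simp add: braid_splines_def)

text \<open>By \<open>pure_tensor_eq_spline_tensor\<close> the generators of the component of degree \<open>d\<close> come from
  homogeneous splines of degree \<open>d\<close>, and these splines form a group. Conversely, translation keeps
  the degree, and \<open>1\<close> has degree \<open>0\<close>.\<close>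

lemma spline_tensor_component:
  "spline_tensor ` component (braid_splines :: ('n::finite mpoly, _) graded_module) d = component D_braid d"
  (is "?L = _")
proof -
  let ?gens = "{pure_tensor specialize log_module x (s :: 'n mpoly) | i j x s.
      i + j = d \<and> x \<in> component log_module i \<and> homogeneous j s}"
  have component: "component D_braid d = generate braid.T ?gens"
    by (simp add: D_braid_def extend_scalars_def)
  have gensI: "pure_tensor specialize log_module x s \<in> ?gens"
    if "i + j = d" "x \<in> component log_module i" "homogeneous j s" for i j x s
    using that by blast
  have gens: "?gens \<subseteq> ?L"
  proof safe
    fix i j and \<theta> :: "'n option mpoly \<Rightarrow> 'n option mpoly" and s :: "'n mpoly"
    assume *: "d = i + j" "\<theta> \<in> component log_module i" "homogeneous j s"
    then have "\<theta> \<in> log_derivations" "\<And>a. homogeneous i (\<theta> (Var a))"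
      by (simp_all add: log_module_def)
    moreover from this(2) have "homogeneous (i + j) (s * specialize (\<theta> (Var a)))" for a
      using homogeneous_mult[OF *(3) homogeneous_specialize[of i "\<theta> (Var a)"]] by (simp add: add.commute)
    ultimately show "pure_tensor specialize log_module \<theta> s \<in> spline_tensor ` component braid_splines (i + j)"
      by (auto simp: pure_tensor_eq_spline_tensor component_braid_splines specialize_log_derivation)
  qed
  have "C \<in> ?L" if "C \<in> generate braid.T ?gens" for C
    using that
  proof (induction rule: generate.induct)
    case one
    then show ?case
      unfolding spline_tensor_zero[symmetric]
      by (intro imageI) (simp add: braid_splines_def)
  next
    case (incl C)
    then show ?case using gens by blast
  next
    case (inv C)
    then have "C \<in> ?L"
      using gens by blast
    then obtain F where "F \<in> carrier braid_splines" "\<forall>a. homogeneous d (F a)" "C = spline_tensor F"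
      by (auto simp: component_braid_splines)
    then have "inv\<^bsub>braid.T\<^esub> C = spline_tensor (\<lambda>a. - F a)" "(\<lambda>a. - F a) \<in> component braid_splines d"
      by (simp_all add: spline_tensor_uminus component_braid_splines homogeneous_uminus braid_splines_closed)
    then show ?case
      by (rule image_eqI)
  next
    case (eng C D)
    then obtain F G where "F \<in> carrier braid_splines" "\<forall>a. homogeneous d (F a)" "C = spline_tensor F"
        "G \<in> carrier braid_splines" "\<forall>a. homogeneous d (G a)" "D = spline_tensor G"
      by (auto simp: component_braid_splines)
    then have "C \<otimes>\<^bsub>braid.T\<^esub> D = spline_tensor (\<lambda>a. F a + G a)" "(\<lambda>a. F a + G a) \<in> component braid_splines d"
      by (simp_all add: spline_tensor_add component_braid_splines homogeneous_add braid_splines_closed)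
    then show ?case
      by (rule image_eqI)
  qed
  moreover have "spline_tensor F \<in> ?gens" if "F \<in> component braid_splines d" for F
  proof -
    have "spline_derivation F \<in> component log_module d"
      using that by (simp add: component_braid_splines log_module_def spline_derivation_log homogeneous_translate)
    moreover have "homogeneous 0 (1 :: 'n mpoly)"
      using homogeneous_Const[of 1] by simp
    ultimately show ?thesis
      unfolding spline_tensor_def by (intro gensI[of d 0]) simp_all
  qed
  ultimately show ?thesis
    unfolding component using generate.incl by (metis (no_types, lifting) image_subset_iff subsetI subset_antisym)
qed

theorem braid_splines_isomorphic_D_braid: "graded_isomorphic braid_splines D_braid"
proof (rule graded_isomorphicI)
  have carrier: "carrier D_braid = carrier braid.T"
    by (simp add: D_braid_def extend_scalars_def)
  show "bij_betw spline_tensor (carrier braid_splines) (carrier D_braid)"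
    unfolding carrier
    by (intro bij_betw_imageI inj_onI spline_tensor_inj) (auto intro: spline_tensor_in_carrier spline_tensor_surj)
  fix F G :: "'a option \<Rightarrow> 'a mpoly"
  assume "F \<in> carrier braid_splines" "G \<in> carrier braid_splines"
  then show "spline_tensor (F \<oplus>\<^bsub>braid_splines\<^esub> G) = spline_tensor F \<oplus>\<^bsub>D_braid\<^esub> spline_tensor G"
    using spline_tensor_add by (simp add: braid_splines_def D_braid_def extend_scalars_def)
next
  fix s and F :: "'a option \<Rightarrow> 'a mpoly" assume "F \<in> carrier braid_splines"
  then show "spline_tensor (s \<odot>\<^bsub>braid_splines\<^esub> F) = s \<odot>\<^bsub>D_braid\<^esub> spline_tensor F"
    using spline_tensor_smult by (simp add: braid_splines_def)
qed (rule spline_tensor_component)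

section \<open>Chambers of the braid arrangement\<close>

text \<open>The homogeneous coordinates of a point, normalized to \<open>0\<close> at the index \<open>None\<close>. In these
  coordinates all hyperplanes of the restricted arrangement have the form \<open>height x a = height x b\<close>.\<close>

definition height :: "rat ^ 'n::finite \<Rightarrow> 'n option \<Rightarrow> rat" where
  "height x a = (case a of None \<Rightarrow> 0 | Some i \<Rightarrow> x $ i)"

lemma height_simps [simp]: "height x None = 0" "height x (Some i) = x $ i"
  by (simp_all add: height_def)

lemma height_add: "height (x + y) a = height x a + height y a"
  by (cases a) simp_all

lemma height_scale: "height (t *s x) a = t * height x a"
  by (cases a) simp_all

lemma height_diff: "height (x - y) a = height x a - height y a"
  by (cases a) simp_all

lemma height_linear: "height x a = (\<Sum>i\<in>UNIV. height (axis i 1) a * x $ i)"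
  by (cases a) (simp_all add: axis_def if_distrib[of "\<lambda>t. t * _"] cong: if_cong)

lemma eval_at_coord: "eval_at (coord a) x = height x a"
  by (cases a) (simp_all add: eval_at_simps)

definition mirror :: "'n::finite option \<Rightarrow> 'n option \<Rightarrow> (rat ^ 'n) set" where
  "mirror a b = {x. height x a = height x b}"

text \<open>The region where the coordinate with index \<open>a\<close> is the smallest one, for \<open>c = 0\<close>; for \<open>c = 1\<close> it
  is cut by one more inequality. The cones of both fans have this form, with \<open>c = 0\<close> for the first
  and \<open>c = 1\<close> for the second. The additional inequality depends on \<open>a\<close> through \<open>height x a\<close> only, so
  it is the same for \<open>a\<close> and \<open>b\<close> on the hyperplane \<open>mirror a b\<close>.\<close>

definition chamber :: "rat \<Rightarrow> 'n::finite option \<Rightarrow> (rat ^ 'n) set" where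
  "chamber c a = {x. (\<forall>b. height x a \<le> height x b) \<and> 0 \<le> c * ((\<Sum>i\<in>UNIV. x $ i) + height x a)}"

text \<open>A part of the common wall of two chambers that is large enough for density arguments: when one of
  the two equal coordinates is dropped, the inequalities describe a box in the remaining ones. The
  bound \<open>n\<close> and the restriction to heights from \<open>-1\<close> to \<open>0\<close> are chosen such that the additional inequality
  of the chambers for \<open>c = 1\<close> holds.\<close>

definition deep_wall :: "'n::finite option \<Rightarrow> 'n option \<Rightarrow> (rat ^ 'n) set" where
  "deep_wall a b = {x. height x a = height x b \<and> -1 \<le> height x a \<and> height x a \<le> 0 \<and>
     (\<forall>i. Some i \<notin> {a, b} \<longrightarrow> of_nat CARD('n) \<le> x $ i)}"

lemma mirror_commute: "mirror a b = mirror b a"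
  by (auto simp: mirror_def)

lemma deep_wall_subset_mirror: "deep_wall a b \<subseteq> mirror a b"
  by (auto simp: deep_wall_def mirror_def)

lemma sum_ge_1:
  fixes x :: "rat ^ 'n::finite"
  assumes "\<And>i. -1 \<le> x $ i" "of_nat CARD('n) \<le> x $ m"
  shows "1 \<le> (\<Sum>i\<in>UNIV. x $ i)"
proof -
  have "(\<Sum>i\<in>UNIV - {m}. -1 :: rat) \<le> (\<Sum>i\<in>UNIV - {m}. x $ i)"
    by (intro sum_mono assms)
  moreover have "(\<Sum>i\<in>UNIV - {m}. -1 :: rat) = 1 - of_nat CARD('n)"
    by (simp add: card_Diff_singleton of_nat_diff Suc_leI)
  moreover have "(\<Sum>i\<in>UNIV. x $ i) = x $ m + (\<Sum>i\<in>UNIV - {m}. x $ i)"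
    by (rule sum.remove) simp_all
  ultimately show ?thesis
    using assms(2) by linarith
qed

text \<open>The values of the parameter of the chambers that are used. For \<open>c = 1\<close> and \<open>n = 2\<close> the chambers
  for the two coordinates of the plane meet only in the origin, so \<open>deep_wall_subset_chamber\<close> fails.\<close>

definition admissible :: "'n::finite itself \<Rightarrow> rat \<Rightarrow> bool" where
  "admissible _ c \<longleftrightarrow> c = 0 \<or> c = 1 \<and> 3 \<le> CARD('n)"

text \<open>For \<open>c = 1\<close> the condition \<open>n \<ge> 3\<close> gives a coordinate different from the two equal ones. It is at
  least \<open>n\<close> and outweighs all the others, which are at least \<open>-1\<close>.\<close>

lemma deep_wall_subset_chamber:
  fixes a b :: "'n::finite option"
  assumes "admissible TYPE('n) c"
  shows "deep_wall a b \<subseteq> chamber c a"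
proof
  fix x assume x: "x \<in> deep_wall a b"
  have *: "height x a \<le> height x k" for k
  proof (cases k)
    case (Some i)
    then show ?thesis
      using x by (cases "k \<in> {a, b}") (auto simp: deep_wall_def intro: order_trans[OF _ of_nat_0_le_iff] order_trans)
  qed (use x in \<open>auto simp: deep_wall_def\<close>)
  have "0 \<le> c * ((\<Sum>i\<in>UNIV. x $ i) + height x a)"
  proof (cases "c = 0")
    case False
    then have c: "c = 1" "3 \<le> CARD('n)"
      using assms by (auto simp: admissible_def)
    have "card (Some -` {a, b}) \<le> card {a, b}"
      by (intro card_inj_on_le[where f = Some]) auto
    also have "\<dots> \<le> 2"
      by (simp add: card_insert_if)
    finally have "Some -` {a, b} \<noteq> UNIV"
      using c(2) by auto
    then obtain m where "Some m \<notin> {a, b}"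
      by blast
    moreover have "-1 \<le> x $ i" for i
      using *[of "Some i"] x by (auto simp: deep_wall_def)
    ultimately have "1 \<le> (\<Sum>i\<in>UNIV. x $ i)"
      using x by (intro sum_ge_1[of x m]) (auto simp: deep_wall_def)
    moreover have "-1 \<le> height x a"
      using x by (simp add: deep_wall_def)
    ultimately show ?thesis
      by (simp add: c(1))
  qed simp
  with * show "x \<in> chamber c a"
    by (simp add: chamber_def)
qed

text \<open>By symmetry \<open>coord a\<close> may be taken to be a variable. Substituting \<open>coord b\<close> for this variable
  changes \<open>p\<close> by a multiple of \<open>coord a - coord b\<close>, and the result vanishes on a box, so it is the
  zero polynomial.\<close>

lemma dvd_if_zero_on_deep_wall:
  assumes "a \<noteq> b" "\<And>x. x \<in> deep_wall a b \<Longrightarrow> eval_at p x = 0"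
  shows "(coord a - coord b) dvd (p :: 'n::finite mpoly)"
proof -
  have Some: "(coord (Some i) - coord b) dvd p"
    if ib: "b \<noteq> Some i" and zero: "\<And>x. x \<in> deep_wall (Some i) b \<Longrightarrow> eval_at p x = 0" for i b
  proof -
    define q where "q = substitute Const (Var(i := coord b)) p"
    have "q = 0"
    proof (rule zero_if_zero_on_box[where A = "\<lambda>k. if b = Some k then {-1..0} else {of_nat CARD('n)..}"])
      fix x :: "rat ^ 'n" assume x: "\<forall>k. x $ k \<in> (if b = Some k then {-1..0} else {of_nat CARD('n)..})"
      have "(\<chi> k. eval_at ((Var(i := coord b)) k) x) = (\<chi> k. if k = i then height x b else x $ k)"
        by (simp add: vec_eq_iff eval_at_simps eval_at_coord)
      moreover have "(\<chi> k. if k = i then height x b else x $ k) \<in> deep_wall (Some i) b"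
        using x ib by (cases b) (auto simp: deep_wall_def split: if_splits)
      ultimately show "eval_at q x = 0"
        by (simp add: q_def eval_at_substitute zero)
    qed (auto simp: infinite_Icc infinite_Ici)
    moreover have "(Var i - coord b) dvd p - q"
      unfolding q_def by (rule dvd_diff_substitute) simp
    ultimately show ?thesis by simp
  qed
  show ?thesis
  proof (cases a)
    case None
    then obtain i where "b = Some i"
      using assms(1) by (cases b) auto
    moreover have "deep_wall b a = deep_wall a b"
      by (auto simp: deep_wall_def)
    ultimately have "(coord b - coord a) dvd p"
      using Some[of a i] assms by auto
    then show ?thesis
      by (subst minus_diff_eq[symmetric], subst minus_dvd_iff)
  qed (use Some assms in auto)
qed

text \<open>The set \<open>deep_wall a b\<close> has interior points in the hyperplane. From such a point \<open>t\<close> a small step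
  in any direction of the hyperplane stays inside, and every vector of the hyperplane is a multiple of
  a difference of two such points. If \<open>None\<close> is one of the two indices, then the
  common height is \<open>0\<close> on the whole hyperplane; otherwise that of \<open>t\<close> has to be kept away from \<open>-1\<close>
  and \<open>0\<close>.\<close>

lemma mirror_subset_span:
  fixes a b :: "'n::finite option"
  assumes "a \<noteq> b"
  shows "mirror a b \<subseteq> vec.span (deep_wall a b)"
proof
  fix x :: "rat ^ 'n" assume x: "x \<in> mirror a b"
  define t :: "rat ^ 'n" where "t = (\<chi> k. if Some k \<in> {a, b} then if None \<in> {a, b} then 0 else - 1 / 2
      else of_nat CARD('n) + 1)"
  define D where "D = 1 + (\<Sum>k\<in>UNIV. \<bar>x $ k\<bar>)"
  define e where "e = 1 / (2 * D)"
  have "0 \<le> (\<Sum>k\<in>UNIV. \<bar>x $ k\<bar>)"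
    by (rule sum_nonneg) simp
  then have D: "0 < D"
    unfolding D_def by linarith
  then have e: "0 < e"
    by (simp add: e_def)
  have small: "\<bar>e * x $ k\<bar> \<le> 1 / 2" for k
  proof -
    have "\<bar>x $ k\<bar> \<le> (\<Sum>k\<in>UNIV. \<bar>x $ k\<bar>)"
      by (rule member_le_sum) simp_all
    then have "e * \<bar>x $ k\<bar> \<le> e * D"
      using e by (intro mult_left_mono) (auto simp: D_def)
    also have "\<dots> = 1 / 2"
      using D by (simp add: e_def)
    finally show ?thesis
      using e by (simp add: abs_mult)
  qed
  have in_wall: "t + s *s x \<in> deep_wall a b" if s: "\<And>k. \<bar>s * x $ k\<bar> \<le> 1 / 2" for s
  proof -
    have *: "- (1 / 2) \<le> s * x $ k" "s * x $ k \<le> 1 / 2" for k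
      using s[of k] by (simp_all only: abs_le_iff minus_le_iff)
    have "of_nat CARD('n) \<le> (t + s *s x) $ i" if "Some i \<notin> {a, b}" for i
      using that *(1)[of i] by (simp add: t_def)
    moreover have "height (t + s *s x) a = height (t + s *s x) b"
      using x assms by (cases a; cases b) (auto simp: mirror_def t_def)
    moreover have "-1 \<le> height (t + s *s x) a \<and> height (t + s *s x) a \<le> 0"
      using x assms *(1)[of "the a"] *(2)[of "the a"] by (cases a; cases b) (auto simp: mirror_def t_def)
    ultimately show ?thesis
      by (simp add: deep_wall_def)
  qed
  have "x = (1 / e) *s ((t + e *s x) - (t + 0 *s x))"
    using e by (simp add: vec_eq_iff)
  also have "\<dots> \<in> vec.span (deep_wall a b)"
    by (intro vec.span_scale vec.span_diff vec.span_base in_wall) (use small in simp_all)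
  finally show "x \<in> vec.span (deep_wall a b)" .
qed

text \<open>Every vector becomes an element of the hyperplane after subtracting a suitable multiple of \<open>w\<close>.\<close>

lemma span_insert_off_mirror:
  fixes a b :: "'n::finite option"
  assumes "mirror a b \<subseteq> vec.span S" "w \<notin> mirror a b"
  shows "vec.span (insert w S) = UNIV"
proof -
  have "z \<in> vec.span (insert w S)" for z
  proof -
    define l where "l = (height z a - height z b) / (height w a - height w b)"
    have "height w a - height w b \<noteq> 0"
      using assms(2) by (simp add: mirror_def)
    then have "l * (height w a - height w b) = height z a - height z b"
      by (simp add: l_def)
    then have "z - l *s w \<in> mirror a b"
      by (simp add: mirror_def height_diff height_scale algebra_simps)
    then have "z - l *s w \<in> vec.span (insert w S)"
      using assms(1) vec.span_mono[of S "insert w S"] by blast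
    then have "(z - l *s w) + l *s w \<in> vec.span (insert w S)"
      by (intro vec.span_add vec.span_scale) (auto intro: vec.span_base)
    then show ?thesis by simp
  qed
  then show ?thesis by blast
qed

lemma mirror_subspace: "vec.subspace (mirror a b)"
  by (auto simp: vec.subspace_def mirror_def height_add height_scale height_def split: option.splits)

lemma dim_UNIV_rat: "vec.dim (UNIV :: (rat ^ 'n::finite) set) = CARD('n)"
  by (simp add: vec.dim_UNIV card_cart_basis)

lemma dim_spanning_mirror:
  fixes a b :: "'n::finite option"
  assumes "a \<noteq> b" "deep_wall a b \<subseteq> S" "S \<subseteq> mirror a b"
  shows "Suc (vec.dim S) = CARD('n)"
proof -
  obtain i where "Some i \<in> {a, b}"
    using assms(1) by (cases a; cases b) auto
  then have w: "axis i 1 \<notin> mirror a b"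
    using assms(1) by (cases a; cases b) (auto simp: mirror_def axis_def)
  have "mirror a b \<subseteq> vec.span S"
    using mirror_subset_span[OF assms(1)] vec.span_mono[OF assms(2)] by blast
  then have "vec.dim (insert (axis i 1) S) = CARD('n)"
    using span_insert_off_mirror[OF _ w] by (metis vec.dim_span dim_UNIV_rat)
  moreover have "axis i 1 \<notin> vec.span S"
    using vec.span_minimal[OF assms(3) mirror_subspace] w by blast
  ultimately show ?thesis
    by (simp add: vec.dim_insert)
qed

lemma dim_chamber:
  fixes a :: "'n::finite option"
  assumes "admissible TYPE('n) c"
  shows "vec.dim (chamber c a) = CARD('n)"
proof -
  \<comment> \<open>A point of the chamber off one of its walls spans the space together with that wall.\<close>
  obtain b w where bw: "w \<in> chamber c a" "w \<notin> mirror a b"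
  proof (cases a)
    case None
    show thesis
    proof (rule that)
      show "(\<chi> i. 1) \<in> chamber c a"
        using assms None by (auto simp: chamber_def admissible_def height_def split: option.split)
      show "(\<chi> i. 1) \<notin> mirror a (Some undefined)"
        using None by (simp add: mirror_def)
    qed
  next
    case (Some i)
    let ?w = "(\<chi> k. if k = i then -1 else of_nat CARD('n)) :: rat ^ 'n"
    have "0 \<le> c * ((\<Sum>k\<in>UNIV. ?w $ k) + height ?w a)"
    proof (cases "c = 0")
      case False
      then have c: "c = 1" "3 \<le> CARD('n)"
        using assms by (auto simp: admissible_def)
      then obtain m where "m \<noteq> i"
        by (metis (full_types) card_1_singleton_iff UNIV_eq_I insertI1 numeral_le_one_iff semiring_norm(70)
            singleton_iff One_nat_def)
      then have "1 \<le> (\<Sum>k\<in>UNIV. ?w $ k)"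
        by (intro sum_ge_1[of ?w m]) (auto intro: order_trans[OF _ of_nat_0_le_iff])
      then show ?thesis
        using c(1) Some by simp
    qed simp
    then have "?w \<in> chamber c a"
      using Some by (auto simp: chamber_def height_def split: option.split intro: order_trans[OF _ of_nat_0_le_iff])
    moreover have "?w \<notin> mirror a None"
      using Some by (simp add: mirror_def)
    ultimately show thesis by (rule that)
  qed
  then have "a \<noteq> b"
    by (auto simp: mirror_def)
  have "vec.span (insert w (chamber c a)) = UNIV"
    using mirror_subset_span[OF \<open>a \<noteq> b\<close>] vec.span_mono[OF deep_wall_subset_chamber[OF assms, of a b]] bw(2)
    by (intro span_insert_off_mirror[of a b]) auto
  then show ?thesis
    using bw(1) by (metis insert_absorb vec.dim_span dim_UNIV_rat)
qed

section \<open>Piecewise polynomials on the chambers\<close>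

lemma chamber_Int_chamber: "chamber c a \<inter> chamber c b \<subseteq> mirror a b"
  by (auto simp: chamber_def mirror_def intro: antisym)

lemma chamber_Int_mirror: "chamber c a \<inter> mirror a b = chamber c b \<inter> mirror a b"
  by (auto simp: chamber_def mirror_def)

lemma cone_face_wall: "cone_face (chamber c a \<inter> mirror a b) (chamber c a)"
proof -
  define u :: "rat ^ 'a" where "u = (\<chi> i. height (axis i 1) b - height (axis i 1) a)"
  have u: "(\<Sum>i\<in>UNIV. u $ i * x $ i) = height x b - height x a" for x
    by (simp add: u_def left_diff_distrib sum_subtractf flip: height_linear)
  show ?thesis
    unfolding cone_face_def by (rule exI[of _ u]) (auto simp: u chamber_def mirror_def)
qed

text \<open>Equal chambers would lie in a hyperplane, but chambers are full-dimensional.\<close>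

lemma chamber_inj:
  fixes a b :: "'n::finite option"
  assumes "admissible TYPE('n) c" "chamber c a = chamber c b"
  shows "a = b"
proof (rule ccontr)
  assume "a \<noteq> b"
  have "chamber c a \<subseteq> mirror a b"
    using chamber_Int_chamber[of c a b] assms(2) by simp
  then have "Suc (vec.dim (chamber c a)) = CARD('n)"
    by (intro dim_spanning_mirror[OF \<open>a \<noteq> b\<close>] deep_wall_subset_chamber assms)
  then show False
    by (simp add: dim_chamber[OF assms(1)])
qed

text \<open>A proper face lies in a hyperplane and has a smaller dimension, so the full-dimensional cones of
  the fan are among the given cones.\<close>

lemma top_cones_fan_of: "top_cones (fan_of \<M>) = {\<sigma> \<in> \<M>. vec.dim \<sigma> = CARD('n)}"
  for \<M> :: "(rat ^ 'n::finite) set set"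
proof (intro equalityI subsetI)
  fix \<tau> :: "(rat ^ 'n) set" assume "\<tau> \<in> top_cones (fan_of \<M>)"
  then obtain \<sigma> u where \<tau>: "vec.dim \<tau> = CARD('n)" "\<sigma> \<in> \<M>" "\<tau> = {x \<in> \<sigma>. (\<Sum>i\<in>UNIV. u $ i * x $ i) = 0}"
    by (auto simp: top_cones_def fan_of_def cone_face_def)
  have "vec.span \<tau> = UNIV"
    using vec.dim_eq_full[of \<tau>] \<tau>(1) by (simp add: vec.dimension_def card_cart_basis)
  moreover have "vec.subspace {x. (\<Sum>i\<in>UNIV. u $ i * x $ i) = 0}"
    by (auto simp: vec.subspace_def distrib_left sum.distrib mult.left_commute simp flip: sum_distrib_left)
  then have "vec.span \<tau> \<subseteq> {x. (\<Sum>i\<in>UNIV. u $ i * x $ i) = 0}"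
    by (intro vec.span_minimal) (use \<tau>(3) in auto)
  ultimately have "\<tau> = \<sigma>"
    using \<tau>(3) by auto
  then show "\<tau> \<in> {\<sigma> \<in> \<M>. vec.dim \<sigma> = CARD('n)}"
    using \<tau> by simp
next
  fix \<sigma> :: "(rat ^ 'n) set" assume "\<sigma> \<in> {\<sigma> \<in> \<M>. vec.dim \<sigma> = CARD('n)}"
  moreover have "cone_face \<sigma> \<sigma>"
    unfolding cone_face_def by (rule exI[of _ 0]) simp
  ultimately show "\<sigma> \<in> top_cones (fan_of \<M>)"
    by (auto simp: top_cones_def fan_of_def)
qed

lemma top_cones_chambers:
  assumes "admissible TYPE('n::finite) c"
  shows "top_cones (fan_of (range (chamber c :: 'n option \<Rightarrow> _))) = range (chamber c)"
  by (auto simp: top_cones_fan_of dim_chamber[OF assms])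

text \<open>Two chambers share the facet in which they meet \<open>mirror a b\<close>. Agreement of two polynomials there
  forces divisibility of the difference because the facet contains \<open>deep_wall a b\<close>. Conversely, any
  common face of the two chambers lies in \<open>mirror a b\<close>, where a multiple of \<open>coord a - coord b\<close>
  vanishes.\<close>

lemma piecewise_polynomials_chambers:
  fixes f :: "(rat ^ 'n::finite) set \<Rightarrow> 'n mpoly"
  assumes "admissible TYPE('n) c"
  shows "f \<in> piecewise_polynomials (fan_of (range (chamber c))) \<longleftrightarrow>
    (\<forall>\<sigma>. \<sigma> \<notin> range (chamber c) \<longrightarrow> f \<sigma> = 0) \<and> (\<lambda>a. f (chamber c a)) \<in> carrier braid_splines"
proof -
  have "(\<forall>\<tau>. cone_face \<tau> (chamber c a) \<and> cone_face \<tau> (chamber c b) \<and> vec.dim \<tau> = CARD('n) - 1 \<longrightarrow>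
      (\<forall>x\<in>\<tau>. eval_at (f (chamber c a)) x = eval_at (f (chamber c b)) x)) \<longleftrightarrow>
    (coord a - coord b) dvd f (chamber c a) - f (chamber c b)" (is "?agree \<longleftrightarrow> ?dvd") for a b
  proof
    assume agree: ?agree
    show ?dvd
    proof (cases "a = b")
      case False
      define \<tau> where "\<tau> = chamber c a \<inter> mirror a b"
      have faces: "cone_face \<tau> (chamber c a)" "cone_face \<tau> (chamber c b)"
        using cone_face_wall[of c a b] cone_face_wall[of c b a]
        by (simp_all only: \<tau>_def chamber_Int_mirror[of c a b] mirror_commute[of b a])
      have wall: "deep_wall a b \<subseteq> \<tau>"
        unfolding \<tau>_def using deep_wall_subset_chamber[OF assms] deep_wall_subset_mirror by blast
      have "Suc (vec.dim \<tau>) = CARD('n)"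
        using False wall by (rule dim_spanning_mirror) (simp add: \<tau>_def)
      then have "vec.dim \<tau> = CARD('n) - 1"
        by simp
      then have "eval_at (f (chamber c a)) x = eval_at (f (chamber c b)) x" if "x \<in> deep_wall a b" for x
        using agree faces wall that by blast
      then show ?thesis
        by (intro dvd_if_zero_on_deep_wall[OF False]) (simp add: eval_at_simps)
    qed simp
  next
    assume ?dvd
    then obtain q where q: "f (chamber c a) - f (chamber c b) = (coord a - coord b) * q"
      by (elim dvdE)
    show ?agree
    proof (intro allI impI ballI, elim conjE)
      fix \<tau> x assume "cone_face \<tau> (chamber c a)" "cone_face \<tau> (chamber c b)" "x \<in> \<tau>"
      then have "x \<in> mirror a b"
        using chamber_Int_chamber[of c a b] by (auto simp: cone_face_def)
      then have "eval_at ((coord a - coord b) * q) x = 0"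
        by (simp add: eval_at_simps eval_at_coord mirror_def)
      then show "eval_at (f (chamber c a)) x = eval_at (f (chamber c b)) x"
        by (simp add: eval_at_simps flip: q)
    qed
  qed
  then show ?thesis
    unfolding piecewise_polynomials_def top_cones_chambers[OF assms] braid_splines_def
    by simp
qed

theorem C0_chambers_isomorphic_braid_splines:
  assumes "admissible TYPE('n::finite) c"
  shows "graded_isomorphic (C0 (fan_of (range (chamber c :: 'n option \<Rightarrow> _)))) braid_splines"
proof -
  define \<Sigma> :: "(rat ^ 'n) set set" where "\<Sigma> = fan_of (range (chamber c))"
  define \<phi> :: "((rat ^ 'n) set \<Rightarrow> 'n mpoly) \<Rightarrow> 'n option \<Rightarrow> 'n mpoly" where "\<phi> f a = f (chamber c a)" for f a
  define \<psi> :: "('n option \<Rightarrow> 'n mpoly) \<Rightarrow> (rat ^ 'n) set \<Rightarrow> 'n mpoly"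
    where "\<psi> F \<sigma> = (if \<sigma> \<in> range (chamber c) then F (inv_into UNIV (chamber c) \<sigma>) else 0)" for F \<sigma>
  have inj: "inj (chamber c :: 'n option \<Rightarrow> _)"
    by (rule injI) (rule chamber_inj[OF assms])
  have top: "top_cones \<Sigma> = range (chamber c)"
    unfolding \<Sigma>_def by (rule top_cones_chambers[OF assms])
  have pp: "f \<in> piecewise_polynomials \<Sigma> \<longleftrightarrow> (\<forall>\<sigma>. \<sigma> \<notin> range (chamber c) \<longrightarrow> f \<sigma> = 0) \<and> \<phi> f \<in> carrier braid_splines" for f
    unfolding \<Sigma>_def piecewise_polynomials_chambers[OF assms] \<phi>_def[abs_def] ..
  have \<phi>\<psi>: "\<phi> (\<psi> F) = F" for F
    by (simp add: \<phi>_def[abs_def] \<psi>_def inv_f_f[OF inj])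
  have \<psi>\<phi>: "\<psi> (\<phi> f) = f" if "f \<in> piecewise_polynomials \<Sigma>" for f
    using that by (auto simp: pp \<psi>_def \<phi>_def fun_eq_iff f_inv_into_f)
  have \<psi>: "\<psi> F \<in> piecewise_polynomials \<Sigma>" if "F \<in> carrier braid_splines" for F
    using that by (simp add: pp \<phi>\<psi>) (simp add: \<psi>_def)
  have "graded_isomorphic (C0 \<Sigma>) braid_splines"
  proof (rule graded_isomorphicI)
    show "bij_betw \<phi> (carrier (C0 \<Sigma>)) (carrier braid_splines)"
      by (rule bij_betw_byWitness[where f' = \<psi>]) (use \<phi>\<psi> \<psi>\<phi> \<psi> pp in \<open>auto simp: C0_def\<close>)
    show "\<phi> ` component (C0 \<Sigma>) d = component braid_splines d" for d
    proof (intro equalityI subsetI)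
      fix F assume "F \<in> \<phi> ` component (C0 \<Sigma>) d"
      then show "F \<in> component braid_splines d"
        by (auto simp: C0_def component_braid_splines pp top) (simp add: \<phi>_def)
    next
      fix F :: "'n option \<Rightarrow> 'n mpoly" assume F: "F \<in> component braid_splines d"
      then have "\<psi> F \<in> component (C0 \<Sigma>) d"
        using \<psi>[of F] by (auto simp: C0_def component_braid_splines top \<psi>_def)
      then show "F \<in> \<phi> ` component (C0 \<Sigma>) d"
        by (rule rev_image_eqI) (simp add: \<phi>\<psi>)
    qed
  qed (simp_all add: C0_def braid_splines_def \<phi>_def fun_eq_iff)
  then show ?thesis
    by (simp add: \<Sigma>_def)
qed

section \<open>The two fans as fans of chambers\<close>

lemma cone_gen_zero: "0 \<in> cone_gen V"
  unfolding cone_gen_def by (rule CollectI, rule exI[of _ "\<lambda>_. 0"]) simp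

lemma cone_gen_add: "x \<in> cone_gen V \<Longrightarrow> y \<in> cone_gen V \<Longrightarrow> x + y \<in> cone_gen V"
proof -
  assume "x \<in> cone_gen V" "y \<in> cone_gen V"
  then obtain c d where "x = (\<Sum>v\<in>V. c v *s v)" "y = (\<Sum>v\<in>V. d v *s v)"
    "\<forall>v\<in>V. 0 \<le> c v" "\<forall>v\<in>V. 0 \<le> d v"
    by (auto simp: cone_gen_def)
  then show ?thesis
    unfolding cone_gen_def
    by (intro CollectI exI[of _ "\<lambda>v. c v + d v"]) (simp add: vec.scale_left_distrib sum.distrib)
qed

lemma cone_gen_scale_generator:
  assumes "finite V" "v \<in> V" "0 \<le> t"
  shows "t *s v \<in> cone_gen V"
proof -
  have "t *s v = (\<Sum>w\<in>V. (if w = v then t else 0) *s w)"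
    using assms(1,2) by (simp add: if_distrib[of "\<lambda>c. c *s _"] cong: if_cong)
  then show ?thesis
    unfolding cone_gen_def using assms(3) by (intro CollectI exI[of _ "\<lambda>w. if w = v then t else 0"]) auto
qed

lemma cone_gen_sum: "(\<And>i. i \<in> I \<Longrightarrow> f i \<in> cone_gen V) \<Longrightarrow> (\<Sum>i\<in>I. f i) \<in> cone_gen V"
  by (induction I rule: infinite_finite_induct) (auto intro: cone_gen_zero cone_gen_add)

lemma cone_gen_subset_chamber:
  assumes "V \<subseteq> chamber c a"
  shows "cone_gen V \<subseteq> chamber c a"
proof
  have zero: "0 \<in> chamber c a"
    by (auto simp: chamber_def height_def split: option.split)
  have add: "x + y \<in> chamber c a" if "x \<in> chamber c a" "y \<in> chamber c a" for x y
  proof -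
    have "height x a + height y a \<le> height x b + height y b" for b
      using that by (intro add_mono) (auto simp: chamber_def)
    moreover have "0 \<le> c * ((\<Sum>i\<in>UNIV. x $ i) + height x a) + c * ((\<Sum>i\<in>UNIV. y $ i) + height y a)"
      using that by (intro add_nonneg_nonneg) (auto simp: chamber_def)
    ultimately show ?thesis
      by (simp add: chamber_def height_add sum.distrib algebra_simps)
  qed
  have scale: "t *s x \<in> chamber c a" if "x \<in> chamber c a" "0 \<le> t" for t x
  proof -
    have "0 \<le> t * (c * ((\<Sum>i\<in>UNIV. x $ i) + height x a))"
      using that by (intro mult_nonneg_nonneg[OF that(2)]) (auto simp: chamber_def)
    also have "\<dots> = c * ((\<Sum>i\<in>UNIV. (t *s x) $ i) + height (t *s x) a)"
      by (simp add: height_scale algebra_simps sum_distrib_left)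
    finally show ?thesis
      unfolding chamber_def using that
      by (intro CollectI conjI allI) (auto simp only: height_scale chamber_def intro: mult_left_mono)
  qed
  fix x assume "x \<in> cone_gen V"
  then obtain t where x: "x = (\<Sum>v\<in>V. t v *s v)" "\<forall>v\<in>V. 0 \<le> t v"
    by (auto simp: cone_gen_def)
  have "(\<Sum>v\<in>W. t v *s v) \<in> chamber c a" if "W \<subseteq> V" for W
    using that by (induction W rule: infinite_finite_induct) (use assms x(2) in \<open>auto intro!: zero add scale\<close>)
  then show "x \<in> chamber c a"
    by (simp add: x(1))
qed

definition P1_ray :: "'n::finite option \<Rightarrow> rat ^ 'n" where
  "P1_ray a = (case a of None \<Rightarrow> - (\<Sum>j\<in>UNIV. axis j 1) | Some i \<Rightarrow> axis i 1)"

lemma sum_axis_nth [simp]: "(\<Sum>j\<in>UNIV. axis j (1::rat)) $ i = 1"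
  by (simp add: axis_def)

lemma height_P1_ray:
  "height (P1_ray (Some i)) a = (if a = Some i then 1 else 0)"
  "height (P1_ray None) a = (if a = None then 0 else -1)"
  by (cases a; simp add: P1_ray_def axis_def)+

text \<open>The rays sum to \<open>0\<close>, so in the representation of a point by its coordinates with respect to all
  \<open>n + 1\<close> rays the smallest coordinate can be subtracted from all of them.\<close>

lemma P1_cone: "cone_gen (P1_ray ` (UNIV - {a})) = chamber 0 (a :: 'n::finite option)"
proof
  show "cone_gen (P1_ray ` (UNIV - {a})) \<subseteq> chamber 0 a"
  proof (rule cone_gen_subset_chamber, rule image_subsetI)
    fix b assume "b \<in> UNIV - {a}"
    then show "P1_ray b \<in> chamber 0 a"
      by (cases b) (auto simp: chamber_def height_P1_ray)
  qed
  show "chamber 0 a \<subseteq> cone_gen (P1_ray ` (UNIV - {a}))"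
  proof
    fix x assume x: "x \<in> chamber 0 a"
    have "x = (\<Sum>b\<in>UNIV. (height x b - height x a) *s P1_ray b)"
      by (simp add: vec_eq_iff UNIV_option_conv sum.reindex P1_ray_def axis_def if_distrib cong: if_cong)
    also have "\<dots> = (\<Sum>b\<in>UNIV - {a}. (height x b - height x a) *s P1_ray b)"
      by (subst sum.remove[of UNIV a]) simp_all
    also have "\<dots> \<in> cone_gen (P1_ray ` (UNIV - {a}))"
      using x by (intro cone_gen_sum cone_gen_scale_generator) (auto simp: chamber_def)
    finally show "x \<in> cone_gen (P1_ray ` (UNIV - {a}))" .
  qed
qed

lemma P1_fan_eq: "P1_fan = fan_of (range (chamber 0 :: 'n::finite option \<Rightarrow> _))"
proof -
  let ?G = "insert (- (\<Sum>j\<in>UNIV. axis j 1)) (range (\<lambda>i. axis i 1)) :: (rat ^ 'n) set"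
  have G: "?G = range P1_ray"
    by (simp add: UNIV_option_conv P1_ray_def image_image)
  have inj: "inj (P1_ray :: 'n option \<Rightarrow> _)"
  proof (rule injI)
    fix a b :: "'n option" assume "P1_ray a = P1_ray b"
    then have "height (P1_ray a) k = height (P1_ray b) k" for k
      by simp
    from this[of a] this[of b] show "a = b"
      by (cases a; cases b) (auto simp: height_P1_ray simp del: height_simps split: if_splits)
  qed
  have "V \<subseteq> ?G \<and> card V = CARD('n) \<longleftrightarrow> (\<exists>a. V = P1_ray ` (UNIV - {a}))" for V
  proof
    assume V: "V \<subseteq> ?G \<and> card V = CARD('n)"
    then obtain B where B: "V = P1_ray ` B"
      unfolding G by (meson subset_imageE)
    then have "card B = CARD('n)"
      using V inj by (simp add: card_image inj_on_subset)
    then have "card (UNIV - B) = 1"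
      by (simp add: card_Diff_subset)
    then obtain a where "UNIV - B = {a}"
      by (auto simp: card_1_singleton_iff)
    then have "B = UNIV - {a}"
      by auto
    then show "\<exists>a. V = P1_ray ` (UNIV - {a})"
      using B by blast
  next
    assume "\<exists>a. V = P1_ray ` (UNIV - {a})"
    then show "V \<subseteq> ?G \<and> card V = CARD('n)"
      unfolding G using inj by (auto simp: card_image inj_on_subset card_Diff_subset)
  qed
  then have "{cone_gen V | V. V \<subseteq> ?G \<and> card V = CARD('n)} = range (\<lambda>a. cone_gen (P1_ray ` (UNIV - {a})))"
    by auto
  then show ?thesis
    unfolding P1_fan_def P1_cone by simp
qed

lemma P2_vertex_nth:
  fixes i j :: "'n::finite"
  shows "P2_vertex j $ i = (if i = j then of_nat CARD('n) else -1)"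
  by (simp add: P2_vertex_def axis_def)

lemma P2_cone_None: "cone_gen (range (\<lambda>i. axis i 1)) = chamber 1 (None :: 'n::finite option)"
proof
  show "cone_gen (range (\<lambda>i. axis i 1)) \<subseteq> chamber 1 (None :: 'n option)"
    by (intro cone_gen_subset_chamber image_subsetI)
      (auto simp: chamber_def height_def axis_def split: option.split)
  show "chamber 1 (None :: 'n option) \<subseteq> cone_gen (range (\<lambda>i. axis i 1))"
  proof
    fix x :: "rat ^ 'n" assume "x \<in> chamber 1 None"
    then have nonneg: "0 \<le> x $ i" for i
      unfolding chamber_def by (auto dest!: spec[of _ "Some i"])
    have "x = (\<Sum>i\<in>UNIV. x $ i *s axis i 1)"
      by (simp add: vec_eq_iff axis_def if_distrib cong: if_cong)
    also have "\<dots> \<in> cone_gen (range (\<lambda>i. axis i 1))"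
      using nonneg by (intro cone_gen_sum cone_gen_scale_generator) auto
    finally show "x \<in> cone_gen (range (\<lambda>i. axis i 1))" .
  qed
qed

text \<open>For a point \<open>x\<close> of the chamber let \<open>- t\<close> be its smallest coordinate, let \<open>r j = x $ j + t\<close>, and let \<open>D\<close>
  be the sum of the numbers \<open>r j\<close>. A representation by the generators with coefficients \<open>u j\<close> and \<open>w j\<close> needs
  \<open>(n + 1) u j + w j = r j\<close>, and its coordinate at \<open>i\<close> needs \<open>\<Sum>\<^sub>j u j = t\<close>. The additional
  inequality of the chamber says \<open>(n + 1) t \<le> D\<close>, so the choice of \<open>u\<close> proportional to \<open>r\<close> leaves
  \<open>w\<close> nonnegative.\<close>

lemma P2_cone_Some:
  "cone_gen (P2_vertex ` {j. j \<noteq> i} \<union> (\<lambda>j. axis j 1) ` {j. j \<noteq> i}) = chamber 1 (Some (i :: 'n::finite))"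
  (is "cone_gen ?V = _")
proof
  have sum_vertex: "(\<Sum>k\<in>UNIV. P2_vertex j $ k) = 1" for j :: 'n
  proof -
    have "(\<Sum>k\<in>UNIV. P2_vertex j $ k) = (\<Sum>k\<in>UNIV. (if k = j then of_nat CARD('n) + 1 else 0) - 1)"
      by (rule sum.cong) (auto simp: P2_vertex_nth)
    then show ?thesis
      by (simp add: sum_subtractf)
  qed
  have "P2_vertex j \<in> chamber 1 (Some i)" if "j \<noteq> i" for j
  proof -
    have "height (P2_vertex j) (Some i) \<le> height (P2_vertex j) b" for b
      using that by (auto simp: height_def P2_vertex_nth split: option.split
          intro: order_trans[OF _ of_nat_0_le_iff])
    moreover have "height (P2_vertex j) (Some i) = -1"
      using that by (simp add: P2_vertex_nth)
    ultimately show ?thesis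
      by (simp add: chamber_def sum_vertex)
  qed
  moreover have "axis j 1 \<in> chamber 1 (Some i)" if "j \<noteq> i" for j
    using that by (auto simp: chamber_def height_def axis_def split: option.split)
  ultimately show "cone_gen ?V \<subseteq> chamber 1 (Some i)"
    by (intro cone_gen_subset_chamber) auto
  show "chamber 1 (Some i) \<subseteq> cone_gen ?V"
  proof
    fix x :: "rat ^ 'n" assume x: "x \<in> chamber 1 (Some i)"
    define t where "t = - x $ i"
    define r where "r j = x $ j + t" for j
    define D where "D = (\<Sum>j | j \<noteq> i. r j)"
    have min: "height x (Some i) \<le> height x b" for b
      using x by (simp add: chamber_def)
    have t: "0 \<le> t" and r: "0 \<le> r j" for j
      using min[of None] min[of "Some j"] by (simp_all add: t_def r_def)
    have "(\<Sum>j\<in>UNIV. x $ j) = (\<Sum>j\<in>UNIV. r j) - of_nat CARD('n) * t"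
      by (simp add: r_def sum.distrib)
    also have "(\<Sum>j\<in>UNIV. r j) = D"
      unfolding D_def by (rule sum.mono_neutral_right) (auto simp: r_def t_def)
    finally have "(\<Sum>j\<in>UNIV. x $ j) = D - of_nat CARD('n) * t" .
    then have D: "(of_nat CARD('n) + 1) * t \<le> D"
      using x by (simp add: chamber_def t_def algebra_simps)
    \<comment> \<open>If \<open>D = 0\<close> then \<open>t\<close> and all \<open>r j\<close> are \<open>0\<close>, and division by zero gives the correct value \<open>0\<close>.\<close>
    define u where "u j = t * r j / D" for j
    have "0 \<le> D"
      unfolding D_def by (rule sum_nonneg) (rule r)
    have u: "0 \<le> u j" "(of_nat CARD('n) + 1) * u j \<le> r j" for j
    proof -
      show "0 \<le> u j"
        using t r \<open>0 \<le> D\<close> by (simp add: u_def)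
      have "(of_nat CARD('n) + 1) * t * r j \<le> D * r j"
        using D r by (rule mult_right_mono)
      then show "(of_nat CARD('n) + 1) * u j \<le> r j"
        using \<open>0 \<le> D\<close> r by (cases "D = 0") (simp_all add: u_def field_simps)
    qed
    have sum_u: "(\<Sum>j | j \<noteq> i. u j) = t"
    proof (cases "D = 0")
      case True
      then have "(of_nat CARD('n) + 1) * t \<le> 0"
        using D by simp
      then have "t = 0"
        using t by (auto simp: mult_le_0_iff add_nonneg_eq_0_iff)
      then show ?thesis
        by (simp add: u_def)
    next
      case False
      have "(\<Sum>j | j \<noteq> i. u j) = t * D / D"
        by (simp add: u_def D_def sum_distrib_left sum_divide_distrib)
      then show ?thesis
        using False by simp
    qed
    have "x $ k = (\<Sum>j | j \<noteq> i. u j *s P2_vertex j + (r j - (of_nat CARD('n) + 1) * u j) *s axis j 1) $ k" for k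
    proof -
      have "(\<Sum>j | j \<noteq> i. u j *s P2_vertex j + (r j - (of_nat CARD('n) + 1) * u j) *s axis j 1) $ k
          = (\<Sum>j | j \<noteq> i. (if k = j then r j else 0) - u j)"
        unfolding sum_component
        by (rule sum.cong) (auto simp: P2_vertex_nth axis_def algebra_simps)
      also have "\<dots> = (if k \<noteq> i then r k else 0) - t"
        by (simp add: sum_subtractf sum_u)
      also have "\<dots> = x $ k"
        by (simp add: r_def t_def)
      finally show ?thesis by simp
    qed
    then have "x = (\<Sum>j | j \<noteq> i. u j *s P2_vertex j + (r j - (of_nat CARD('n) + 1) * u j) *s axis j 1)"
      by (simp add: vec_eq_iff)
    also have "\<dots> \<in> cone_gen ?V"
      using u by (intro cone_gen_sum cone_gen_add cone_gen_scale_generator) auto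
    finally show "x \<in> cone_gen ?V" .
  qed
qed

lemma P2_fan_eq: "P2_fan = fan_of (range (chamber 1 :: 'n::finite option \<Rightarrow> _))"
proof -
  have "range (chamber 1 :: 'n option \<Rightarrow> _) = insert (chamber 1 None) {chamber 1 (Some i) | i. True}"
    by (auto simp: UNIV_option_conv)
  then show ?thesis
    by (simp add: P2_fan_def P2_cone_None P2_cone_Some)
qed

theorem theorem3:
  shows "graded_isomorphic (C0 (P1_fan :: (rat ^ 'n::finite) set set)) D_braid \<and>
    (3 \<le> CARD('n) \<longrightarrow>
      graded_isomorphic (C0 (P2_fan :: (rat ^ 'n) set set)) D_braid)"
proof -
  have "graded_isomorphic (C0 (fan_of (range (chamber c :: 'n option \<Rightarrow> _)))) D_braid"
    if "admissible TYPE('n) c" for c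
    using C0_chambers_isomorphic_braid_splines[OF that] braid_splines_isomorphic_D_braid
    by (rule graded_isomorphic_trans)
  then show ?thesis
    by (simp add: P1_fan_eq P2_fan_eq admissible_def)
qed

end
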